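(* (1) A vector $c\in V$ is tight if and only if $c$ has an $XY$-slope decomposition. (2) Suppose $c=c_1+c_2+\cdots+c_r$ is an $XY$-slope decomposition and let $x_i=\|c_i\|_X$, $y_i=\|c_i\|_Y$. Then $\|c\|_X=\sum_{i=1}^r x_i$, $\|c\|_Y=\sum_{i=1}^r y_i$, $f^c_{YX}=h^c_{YX}$, and the graph of $f^c_{YX}$ on $[0,\|c\|_X]$ is the piecewise linear curve through the points $(x_1+\cdots+x_i,\ y_{i+1}+\cdots+y_r)$, $i=0,1,\dots,r$.
   Context: $V$ is a finite dimensional real vector space with a positive definite symmetric bilinear form $\langle\cdot,\cdot\rangle$, $\|v\|_2=\sqrt{\langle v,v\rangle}$; $\|\cdot\|_X$ is a norm on $V$ with dual norm $\|v\|_Y=\max\{\langle v,w\rangle:\|w\|_X=1\}$. For norms $\|\cdot\|_P,\|\cdot\|_Q$ (among $X,Y,2$), $c=a+b$ is a $PQ$-decomposition if for every decomposition $c=a'+b'$: $\|a'\|_P>\|a\|_P$, or $\|b'\|_Q>\|b\|_Q$, or $(\|a'\|_P,\|b'\|_Q)=(\|a\|_P,\|b\|_Q)$. The vector $c$ is tight if every $X2$-decomposition of $c$ is an $XY$-decomposition. For $x\in[0,\|c\|_X]$: $f^c_{YX}(x)=\min\{\|c-a\|_Y:\|a\|_X\le x\}$; $\alpha^c_{2X}(x)$ is the unique minimizer of $\|c-a\|_2$ subject to $\|a\|_X\le x$, and $h^c_{YX}(x)=\|c-\alpha^c_{2X}(x)\|_Y$. For nonzero $v$, $\mu_{XY}(v)=\|v\|_Y/\|v\|_X$.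 An expression $c=c_1+\cdots+c_r$ is an $XY$-slope decomposition if all $c_i$ are nonzero, $\langle c_i,c_j\rangle=\|c_i\|_X\|c_j\|_Y$ for all $i\le j$, and $\mu_{XY}(c_1)>\mu_{XY}(c_2)>\cdots>\mu_{XY}(c_r)$. *)

theory Defs
  imports "HOL-Analysis.Analysis"
begin

text \<open>V is modelled by a type of class euclidean_space (finite dimensional real
inner product space); the bilinear form is the inner product and the 2-norm is norm.\<close>

definition is_norm :: "('a::real_vector \<Rightarrow> real) \<Rightarrow> bool" where
  "is_norm N \<longleftrightarrow> (\<forall>v. 0 \<le> N v) \<and> (\<forall>v. N v = 0 \<longleftrightarrow> v = 0)
     \<and> (\<forall>s v. N (s *\<^sub>R v) = \<bar>s\<bar> * N v) \<and> (\<forall>u v. N (u + v) \<le> N u + N v)"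

definition dual_norm :: "('a::real_inner \<Rightarrow> real) \<Rightarrow> 'a \<Rightarrow> real" where
  "dual_norm N v = Sup {inner v w | w. N w = 1}"

definition PQ_decomp :: "('a::real_vector \<Rightarrow> real) \<Rightarrow> ('a \<Rightarrow> real) \<Rightarrow> 'a \<Rightarrow> 'a \<Rightarrow> 'a \<Rightarrow> bool" where
  "PQ_decomp P Q c a b \<longleftrightarrow> c = a + b \<and>
     (\<forall>a' b'. c = a' + b' \<longrightarrow> P a' > P a \<or> Q b' > Q b \<or> (P a' = P a \<and> Q b' = Q b))"

definition tight :: "('a::real_inner \<Rightarrow> real) \<Rightarrow> 'a \<Rightarrow> bool" where
  "tight NX c \<longleftrightarrow> (\<forall>a b. PQ_decomp NX norm c a b \<longrightarrow> PQ_decomp NX (dual_norm NX) c a b)"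

definition f_YX :: "('a::real_inner \<Rightarrow> real) \<Rightarrow> 'a \<Rightarrow> real \<Rightarrow> real" where
  "f_YX NX c x = Inf {dual_norm NX (c - a) | a. NX a \<le> x}"

definition alpha_2X :: "('a::real_inner \<Rightarrow> real) \<Rightarrow> 'a \<Rightarrow> real \<Rightarrow> 'a" where
  "alpha_2X NX c x = (THE a. NX a \<le> x \<and> (\<forall>a'. NX a' \<le> x \<longrightarrow> norm (c - a) \<le> norm (c - a')))"

definition h_YX :: "('a::real_inner \<Rightarrow> real) \<Rightarrow> 'a \<Rightarrow> real \<Rightarrow> real" where
  "h_YX NX c x = dual_norm NX (c - alpha_2X NX c x)"

definition mu_XY :: "('a::real_inner \<Rightarrow> real) \<Rightarrow> 'a \<Rightarrow> real" where
  "mu_XY NX v = dual_norm NX v / NX v"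

definition slope_decomp :: "('a::real_inner \<Rightarrow> real) \<Rightarrow> 'a \<Rightarrow> 'a list \<Rightarrow> bool" where
  "slope_decomp NX c cs \<longleftrightarrow> c = sum_list cs \<and> (\<forall>i<length cs. cs ! i \<noteq> 0)
     \<and> (\<forall>i j. i \<le> j \<and> j < length cs \<longrightarrow> inner (cs ! i) (cs ! j) = NX (cs ! i) * dual_norm NX (cs ! j))
     \<and> (\<forall>i j. i < j \<and> j < length cs \<longrightarrow> mu_XY NX (cs ! i) > mu_XY NX (cs ! j))"

end

theory Submission
  imports Defs
begin

text \<open>
  An \<open>X2\<close>-decomposition is a splitting \<open>c = a + b\<close> with \<open>\<langle>a, b\<rangle> = \<parallel>a\<parallel>\<^sub>X \<parallel>b\<parallel>\<^sub>Y\<close>.  For a slope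
  decomposition these are exactly the splittings along the polygonal path through the partial
  sums, and testing an arbitrary \<open>c - a'\<close> against \<open>c\<^sub>i\<close> shows that they are \<open>XY\<close>-optimal.

  Conversely let \<open>c\<close> be tight, \<open>a(t)\<close> the point of the \<open>X\<close>-ball of radius \<open>t\<close> nearest to \<open>c\<close>, and
  \<open>h(t) = \<parallel>c - a(t)\<parallel>\<^sub>Y\<close>.  Optimality in \<open>X\<close> and \<open>Y\<close> gives by separation, at every interior \<open>t\<close>, a
  slope \<open>m(t)\<close> and a vector \<open>w(t)\<close> with \<open>\<parallel>w\<parallel>\<^sub>X \<le> 1\<close>, \<open>\<parallel>w\<parallel>\<^sub>Y \<le> m\<close>, \<open>\<langle>a, w\<rangle> = m t\<close> and \<open>\<langle>b, w\<rangle> = h\<close>.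
  Since \<open>\<parallel>w\<parallel>\<^sub>2\<^sup>2 \<le> m\<close> while \<open>\<parallel>a(t) - a(s)\<parallel>\<^sub>2\<^sup>2 \<le> (t - s)(h(s) - h(t))\<close>, \<open>w\<close> is essentially the derivative
  of \<open>a\<close>, so \<open>a\<close> has unit speed in \<open>X\<close> and speed \<open>- h'\<close> in \<open>Y\<close>.  Comparing norms, increments over
  successive intervals satisfy the slope condition with equality.  Hence second differences of \<open>a\<close>
  over disjoint intervals are orthogonal; as they do not vanish around a kink of \<open>h\<close>, there are at
  most \<open>dim V\<close> kinks, and the increments of \<open>a\<close> between consecutive kinks form the decomposition.
\<close>

subsection \<open>Norms and their duals\<close>

locale norm_function =
  fixes N :: "'a::euclidean_space \<Rightarrow> real"
  assumes is_norm: "is_norm N"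
begin

lemma nonneg [simp]: "0 \<le> N v"
  and eq_0_iff [simp]: "N v = 0 \<longleftrightarrow> v = 0"
  and scaleR: "N (s *\<^sub>R v) = \<bar>s\<bar> * N v"
  and triangle: "N (u + v) \<le> N u + N v"
  using is_norm by (auto simp: is_norm_def)

lemma zero [simp]: "N 0 = 0"
  by simp

lemma pos_iff: "0 < N v \<longleftrightarrow> v \<noteq> 0"
  using nonneg[of v] eq_0_iff[of v] by linarith

lemma le_0_iff [simp]: "N v \<le> 0 \<longleftrightarrow> v = 0"
  using pos_iff[of v] by (simp flip: not_less)

lemma uminus: "N (- v) = N v"
  using scaleR[of "-1" v] by simp

lemma diff_triangle: "N u - N v \<le> N (u - v)"
  using triangle[of "u - v" v] by simp

lemma sum_triangle: "N (sum f A) \<le> (\<Sum>i\<in>A. N (f i))"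
proof (induction A rule: infinite_finite_induct)
  case (insert x F)
  then show ?case
    using triangle[of "f x" "sum f F"] by simp
qed auto

lemma bounded_by_norm: "\<exists>C>0. \<forall>v. N v \<le> C * norm v"
proof (intro exI conjI allI)
  show "0 < 1 + (\<Sum>b\<in>Basis. N (b::'a))"
    by (intro add_pos_nonneg sum_nonneg) auto
  fix v :: 'a
  have "N v = N (\<Sum>b\<in>Basis. (v \<bullet> b) *\<^sub>R b)"
    by (simp add: euclidean_representation)
  also have "\<dots> \<le> (\<Sum>b\<in>Basis. \<bar>v \<bullet> b\<bar> * N b)"
    using sum_triangle[of "\<lambda>b. (v \<bullet> b) *\<^sub>R b" Basis] by (simp add: scaleR)
  also have "\<dots> \<le> (\<Sum>b\<in>Basis. norm v * N b)"
    by (intro sum_mono mult_right_mono) (auto simp: Basis_le_norm)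
  also have "\<dots> \<le> (1 + (\<Sum>b\<in>Basis. N b)) * norm v"
    by (simp add: sum_distrib_left algebra_simps)
  finally show "N v \<le> (1 + (\<Sum>b\<in>Basis. N (b::'a))) * norm v" .
qed

lemma continuous: "continuous_on S N"
proof -
  obtain C where C: "C > 0" "\<And>v. N v \<le> C * norm v"
    using bounded_by_norm by blast
  have "\<bar>N u - N v\<bar> \<le> C * norm (u - v)" for u v
    using diff_triangle[of u v] diff_triangle[of v u] C(2)[of "u - v"] C(2)[of "v - u"]
    by (auto simp: norm_minus_commute)
  then have "C-lipschitz_on S N"
    using C(1) by (intro lipschitz_onI) (auto simp: dist_norm)
  then show ?thesis
    by (rule lipschitz_on_continuous_on)
qed

lemma norm_bounded: "\<exists>C>0. \<forall>v. norm v \<le> C * N v"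
proof -
  obtain b :: 'a where "b \<in> Basis"
    using nonempty_Basis by blast
  then have "sphere (0::'a) 1 \<noteq> {}"
    by (auto intro!: exI[of _ b])
  then obtain u :: 'a where u: "u \<in> sphere 0 1" "\<And>v. v \<in> sphere 0 1 \<Longrightarrow> N u \<le> N v"
    using continuous_attains_inf[OF compact_sphere _ continuous] by blast
  have pos: "0 < N u"
    using u(1) by (auto simp: pos_iff)
  have "norm v \<le> inverse (N u) * N v" for v
  proof (cases "v = 0")
    case False
    then have "N u \<le> N ((1 / norm v) *\<^sub>R v)"
      by (intro u(2)) simp
    then show ?thesis
      using pos False by (simp add: scaleR field_simps)
  qed simp
  then show ?thesis
    using pos by (intro exI[of _ "inverse (N u)"]) auto
qed

lemma unit_vector: "v \<noteq> 0 \<Longrightarrow> N ((1 / N v) *\<^sub>R v) = 1"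
  by (simp add: scaleR)

lemma unit_vector_exists: "\<exists>w. N w = 1"
proof -
  obtain b :: 'a where "b \<in> Basis"
    using nonempty_Basis by blast
  then show ?thesis
    using unit_vector[of b] nonzero_Basis by blast
qed

lemma closed_norm_ball: "closed {v. N v \<le> x}"
  by (intro closed_Collect_le continuous continuous_on_const)

lemma convex_combination_le:
  assumes "0 \<le> s" "0 \<le> t"
  shows "N (s *\<^sub>R u + t *\<^sub>R v) \<le> s * N u + t * N v"
  using triangle[of "s *\<^sub>R u" "t *\<^sub>R v"] assms by (simp add: scaleR)

lemma convex_norm_ball: "convex {v. N v \<le> x}"
proof (rule convexI)
  fix u v s t assume *: "u \<in> {v. N v \<le> x}" "v \<in> {v. N v \<le> x}" "0 \<le> s" "0 \<le> t" "s + t = (1::real)"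
  have "s * N u + t * N v \<le> s * x + t * x"
    using * by (intro add_mono mult_left_mono) auto
  then show "s *\<^sub>R u + t *\<^sub>R v \<in> {v. N v \<le> x}"
    using convex_combination_le[of s t u v] * by (simp flip: distrib_right)
qed

end

section \<open>The dual norm and the bipolar property\<close>

locale norm_dual_pair = norm_function
begin

abbreviation D :: "'a \<Rightarrow> real" where "D \<equiv> dual_norm N"

lemma bdd_above_dual: "bdd_above {v \<bullet> w | w. N w = 1}"
proof -
  obtain C where C: "C > 0" "\<And>v. norm v \<le> C * N v"
    using norm_bounded by blast
  have "v \<bullet> w \<le> norm v * C" if "N w = 1" for w
  proof -
    have "v \<bullet> w \<le> norm v * norm w"
      by (rule norm_cauchy_schwarz)
    also have "\<dots> \<le> norm v * C"
      using C(2)[of w] that by (intro mult_left_mono) auto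
    finally show ?thesis .
  qed
  then show ?thesis
    by (auto simp: bdd_above_def)
qed

lemma inner_le: "v \<bullet> w \<le> N w * D v"
proof (cases "w = 0")
  case False
  then have "v \<bullet> ((1 / N w) *\<^sub>R w) \<le> D v"
    unfolding dual_norm_def using unit_vector by (intro cSup_upper bdd_above_dual) blast
  then show ?thesis
    using pos_iff[of w] False by (simp add: field_simps)
qed simp

lemma inner_le': "v \<bullet> w \<le> N v * D w"
  using inner_le[of w v] by (simp add: inner_commute)

lemma dual_le:
  assumes "\<And>w. v \<bullet> w \<le> k * N w"
  shows "D v \<le> k"
  unfolding dual_norm_def
proof (rule cSup_least)
  show "{v \<bullet> w |w. N w = 1} \<noteq> {}"
    using unit_vector_exists by blast
  show "x \<le> k" if "x \<in> {v \<bullet> w |w. N w = 1}" for x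
    using that assms by (auto, metis mult.right_neutral)
qed

lemma dual_is_norm: "is_norm D"
  unfolding is_norm_def
proof (intro conjI allI)
  have nonneg: "0 \<le> D v" for v
  proof -
    obtain w where w: "N w = 1"
      using unit_vector_exists by blast
    show ?thesis
      using inner_le[of v w] inner_le[of v "- w"] w by (simp add: uminus)
  qed
  show "0 \<le> D v" for v
    by (rule nonneg)
  have zero: "D 0 = 0"
    using dual_le[of 0 0] nonneg[of 0] by simp
  show "D v = 0 \<longleftrightarrow> v = 0" for v
    using inner_le[of v v] zero inner_gt_zero_iff[of v] by fastforce
  show "D (u + v) \<le> D u + D v" for u v
  proof (rule dual_le)
    show "(u + v) \<bullet> w \<le> (D u + D v) * N w" for w
      using inner_le[of u w] inner_le[of v w] by (simp add: inner_add_left algebra_simps)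
  qed
  have *: "D (s *\<^sub>R v) \<le> \<bar>s\<bar> * D v" for s v
  proof (rule dual_le)
    show "s *\<^sub>R v \<bullet> w \<le> \<bar>s\<bar> * D v * N w" for w
      using inner_le[of v "s *\<^sub>R w"] by (simp add: scaleR algebra_simps)
  qed
  show "D (s *\<^sub>R v) = \<bar>s\<bar> * D v" for s v
  proof (cases "s = 0")
    case False
    then show ?thesis
      using *[of s v] *[of "1 / s" "s *\<^sub>R v"] by (auto simp: field_simps)
  qed (simp add: zero)
qed

sublocale dual: norm_function D
  by unfold_locales (rule dual_is_norm)

text \<open>The nontrivial half of the bipolar theorem for the unit ball of \<open>N\<close>.\<close>

lemma le_of_inner_le_dual:
  assumes "\<And>v. v \<bullet> w \<le> D v"
  shows "N w \<le> 1"
proof (rule ccontr)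
  assume "\<not> N w \<le> 1"
  then obtain u b where u: "u \<bullet> w < b" "\<And>v. N v \<le> 1 \<Longrightarrow> b < u \<bullet> v"
    using separating_hyperplane_closed_point[OF convex_norm_ball closed_norm_ball, of w 1] by auto
  have "b < 0"
    using u(2)[of 0] by simp
  \<comment> \<open>Rescaling the separation from the unit ball bounds \<open>D (- u)\<close> by
    \<open>- b\<close>, while \<open>- u\<close> pairs with \<open>w\<close> to more than
    \<open>- b\<close>.\<close>
  have "D (- u) \<le> - b"
  proof (rule dual_le)
    fix v
    show "- u \<bullet> v \<le> - b * N v"
    proof (cases "v = 0")
      case False
      then have "b < u \<bullet> ((1 / N v) *\<^sub>R v)"
        by (intro u(2)) (simp add: unit_vector)
      then show ?thesis
        using False pos_iff[of v] by (simp add: field_simps)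
    qed simp
  qed
  then show False
    using assms[of "- u"] u(1) by simp
qed

section \<open>Nearest points in balls and X2-decompositions\<close>

lemma norm_square_le: "(norm v)\<^sup>2 \<le> N v * D v"
  using inner_le'[of v v] by (simp add: power2_norm_eq_inner)

text \<open>Equality in the Hoelder inequality makes \<open>b\<close> an outer normal at
  \<open>a\<close> to the ball of radius \<open>N a\<close>. The quadratic gain in
  \<open>key\<close> yields minimality together with the uniqueness that \<open>THE\<close> in
  \<open>alpha_2X\<close> requires.\<close>

lemma alpha_eqI:
  assumes "c = a + b" "a \<bullet> b = N a * D b"
  shows "alpha_2X N c (N a) = a"
    and "N a' \<le> N a \<Longrightarrow> norm (c - a') \<le> norm (c - a) \<Longrightarrow> a' = a"
proof -
  have key: "(norm (c - a'))\<^sup>2 \<ge> (norm (c - a))\<^sup>2 + (norm (a - a'))\<^sup>2" if "N a' \<le> N a" for a'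
  proof -
    have "a' \<bullet> b \<le> N a' * D b"
      by (rule inner_le')
    also have "\<dots> \<le> a \<bullet> b"
      using that assms(2) by (simp add: mult_right_mono)
    finally have "0 \<le> b \<bullet> (a - a')"
      by (simp add: inner_diff_right inner_commute)
    then have "(norm (b + (a - a')))\<^sup>2 \<ge> (norm b)\<^sup>2 + (norm (a - a'))\<^sup>2"
      unfolding power2_norm_eq_inner inner_add_left inner_add_right by (simp add: inner_commute)
    moreover have "b + (a - a') = c - a'" "b = c - a"
      using assms(1) by auto
    ultimately show ?thesis
      by metis
  qed
  have le: "norm (c - a) \<le> norm (c - a')" if "N a' \<le> N a" for a'
    using key[OF that] by (smt (verit) norm_ge_zero power2_le_imp_le zero_le_power2)
  show uniq: "a' = a" if "N a' \<le> N a" "norm (c - a') \<le> norm (c - a)" for a'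
  proof -
    have "(norm (c - a'))\<^sup>2 \<le> (norm (c - a))\<^sup>2"
      using that(2) by (intro power_mono) auto
    then have "(norm (a - a'))\<^sup>2 \<le> 0"
      using key[OF that(1)] by linarith
    then show ?thesis
      by simp
  qed
  show "alpha_2X N c (N a) = a"
    unfolding alpha_2X_def using le uniq by (intro the_equality) auto
qed

text \<open>The variational inequality of the nearest point says that \<open>c - a\<close>, as a
  functional, attains its maximum over the ball at \<open>a\<close>; rescaled, this is Hoelder
  equality.\<close>

lemma projection_exists:
  assumes "0 \<le> t" "t \<le> N c"
  shows "\<exists>a. N a = t \<and> a \<bullet> (c - a) = t * D (c - a)"
proof -
  let ?B = "{v. N v \<le> t}"
  define a where "a = closest_point ?B c"
  have ne: "?B \<noteq> {}"
    using assms(1) by (auto intro!: exI[of _ 0])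
  have a: "N a \<le> t"
    using closest_point_in_set[OF closed_norm_ball ne, of c] by (simp add: a_def)
  have dot: "(c - a) \<bullet> w \<le> (c - a) \<bullet> a" if "N w \<le> t" for w
    using closest_point_dot[OF convex_norm_ball closed_norm_ball, of w t c] that
    by (simp add: a_def inner_diff_right)
  have ge: "t * D (c - a) \<le> a \<bullet> (c - a)"
  proof (cases "t = 0")
    case False
    have "D (c - a) \<le> (a \<bullet> (c - a)) / t"
    proof (rule dual_le)
      fix w
      show "(c - a) \<bullet> w \<le> a \<bullet> (c - a) / t * N w"
      proof (cases "w = 0")
        case wz: False
        have "(c - a) \<bullet> ((t / N w) *\<^sub>R w) \<le> (c - a) \<bullet> a"
          using assms(1) wz by (intro dot) (simp add: scaleR)
        then show ?thesis
          using wz pos_iff[of w] assms(1) False by (simp add: field_simps inner_commute)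
      qed simp
    qed
    then show ?thesis
      using assms(1) False by (simp add: field_simps)
  qed (use dot[of 0] assms in \<open>auto simp: inner_commute\<close>)
  \<comment> \<open>If \<open>N a < t\<close>, Hoelder equality forces \<open>D (c - a) = 0\<close>,
    so \<open>a = c\<close>, against \<open>t \<le> N c\<close>.\<close>
  have "N a = t"
  proof (rule ccontr)
    assume "N a \<noteq> t"
    then have lt: "N a < t"
      using a by simp
    moreover have "t * D (c - a) \<le> N a * D (c - a)"
      using ge inner_le'[of a "c - a"] by linarith
    ultimately have "D (c - a) = 0"
      using dual.nonneg[of "c - a"] by (smt (verit) mult_strict_right_mono)
    then show False
      using lt assms(2) by simp
  qed
  then show ?thesis
    using ge inner_le'[of a "c - a"] by (intro exI[of _ a]) auto
qed

text \<open>Comparison with the trivial splitting \<open>c = c + 0\<close>.\<close>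

lemma X2_decomp_le:
  assumes "PQ_decomp N norm c a b"
  shows "N a \<le> N c"
proof -
  have "N c > N a \<or> norm (0::'a) > norm b \<or> N c = N a \<and> norm (0::'a) = norm b"
    using assms unfolding PQ_decomp_def by (metis add.right_neutral)
  then show ?thesis
    by (auto simp: not_less)
qed

text \<open>An optimal \<open>a\<close> is the nearest point of its own ball, hence the point from
  \<open>projection_exists\<close>; conversely \<open>alpha_eqI\<close> rules out any other
  competitor that is no worse in both norms.\<close>

lemma X2_decomp_iff: "PQ_decomp N norm c a b \<longleftrightarrow> c = a + b \<and> a \<bullet> b = N a * D b"
proof
  assume decomp: "PQ_decomp N norm c a b"
  then have c: "c = a + b"
    by (simp add: PQ_decomp_def)
  have alt: "N a' > N a \<or> norm b' > norm b \<or> N a' = N a \<and> norm b' = norm b" if "c = a' + b'" for a' b'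
    using that decomp by (auto simp: PQ_decomp_def)
  obtain p where p: "N p = N a" "p \<bullet> (c - p) = N a * D (c - p)"
    using projection_exists[of "N a" c] X2_decomp_le[OF decomp] by auto
  have "norm (c - a) \<le> norm (c - p)"
    using alt[of p "c - p"] p(1) c by auto
  then have "a = p"
    using alpha_eqI(2)[of c p "c - p" a] p by simp
  then show "c = a + b \<and> a \<bullet> b = N a * D b"
    using p c by simp
next
  assume *: "c = a + b \<and> a \<bullet> b = N a * D b"
  show "PQ_decomp N norm c a b"
    unfolding PQ_decomp_def
  proof (intro conjI allI impI)
    fix a' b' assume c: "c = a' + b'"
    show "N a' > N a \<or> norm b' > norm b \<or> N a' = N a \<and> norm b' = norm b"
    proof (cases "N a' \<le> N a \<and> norm b' \<le> norm b")
      case True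
      have "norm (c - a') \<le> norm (c - a)"
        using True c * by (metis add_diff_cancel_left')
      then have "a' = a"
        using alpha_eqI(2)[of c a b a'] * True by simp
      then show ?thesis
        using c * by auto
    qed auto
  qed (use * in simp)
qed

text \<open>The pairs \<open>(\<alpha>, \<beta>)\<close> bounding \<open>(N a', D b')\<close> for decompositions \<open>v = a' + b'\<close> form,
  together with \<open>v\<close>, a convex cone; \<open>w\<close> and \<open>m\<close> come from a hyperplane supporting it at \<open>(c, N a, D b)\<close>.\<close>

lemma pareto_multiplier:
  assumes c: "c = a + b" "0 < N a" "0 < D b"
    and pareto: "\<And>a' b'. c = a' + b' \<Longrightarrow> N a' < N a \<Longrightarrow> D b' < D b \<Longrightarrow> False"
  shows "\<exists>m w. 0 < m \<and> N w \<le> 1 \<and> D w \<le> m \<and> a \<bullet> w = m * N a \<and> b \<bullet> w = D b"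
proof -
  \<comment> \<open>The strict inequalities keep the boundary point \<open>(c, N a, D b)\<close>
    outside \<open>S\<close>; that is exactly \<open>pareto\<close>.\<close>
  define S :: "('a \<times> real \<times> real) set" where
    "S = {(a' + b', \<alpha>, \<beta>) | a' b' \<alpha> \<beta>. N a' < \<alpha> \<and> D b' < \<beta>}"
  have "convex S"
  proof (rule convexI)
    fix p q :: "'a \<times> real \<times> real" and u v :: real
    assume *: "p \<in> S" "q \<in> S" "0 \<le> u" "0 \<le> v" "u + v = 1"
    then obtain a1 b1 \<alpha>1 \<beta>1 a2 b2 \<alpha>2 \<beta>2 where
      p: "p = (a1 + b1, \<alpha>1, \<beta>1)" "N a1 < \<alpha>1" "D b1 < \<beta>1" and
      q: "q = (a2 + b2, \<alpha>2, \<beta>2)" "N a2 < \<alpha>2" "D b2 < \<beta>2"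
      by (auto simp: S_def)
    have strict: "u * x1 + v * x2 < u * y1 + v * y2" if "x1 < y1" "x2 < y2" for x1 x2 y1 y2 :: real
    proof (cases "u = 0")
      case False
      then show ?thesis
        using * that by (intro add_less_le_mono mult_strict_left_mono mult_left_mono) auto
    qed (use * that in simp)
    have "N (u *\<^sub>R a1 + v *\<^sub>R a2) < u * \<alpha>1 + v * \<alpha>2"
      using convex_combination_le[OF *(3,4), of a1 a2] strict[OF p(2) q(2)] by linarith
    moreover have "D (u *\<^sub>R b1 + v *\<^sub>R b2) < u * \<beta>1 + v * \<beta>2"
      using dual.convex_combination_le[OF *(3,4), of b1 b2] strict[OF p(3) q(3)] by linarith
    moreover have "u *\<^sub>R p + v *\<^sub>R q
        = ((u *\<^sub>R a1 + v *\<^sub>R a2) + (u *\<^sub>R b1 + v *\<^sub>R b2), u * \<alpha>1 + v * \<alpha>2, u * \<beta>1 + v * \<beta>2)"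
      by (simp add: p q algebra_simps)
    ultimately show "u *\<^sub>R p + v *\<^sub>R q \<in> S"
      unfolding S_def by blast
  qed
  moreover have "(0 + 0, 1, 1) \<in> S"
    unfolding S_def by (rule CollectI, intro exI[of _ 0] exI[of _ 1]) simp
  then have "S \<noteq> {}"
    by blast
  moreover have "S \<inter> {(c, N a, D b)} = {}"
    using pareto by (auto simp: S_def)
  ultimately obtain \<xi> :: "'a \<times> real \<times> real" and \<gamma> where \<xi>: "\<xi> \<noteq> 0"
    "\<forall>p\<in>S. \<xi> \<bullet> p \<le> \<gamma>" "\<xi> \<bullet> (c, N a, D b) \<ge> \<gamma>"
    using separating_hyperplane_sets[of S "{(c, N a, D b)}"] by auto
  obtain w m1' m2' where "\<xi> = (w, m1', m2')"
    by (cases \<xi>) auto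
  moreover define m1 m2 where "m1 = - m1'" and "m2 = - m2'"
  ultimately have \<xi>_eq: "\<xi> = (w, - m1, - m2)"
    by simp
  have sep: "w \<bullet> (a' + b') - m1 * \<alpha> - m2 * \<beta> \<le> \<gamma>" if "N a' < \<alpha>" "D b' < \<beta>" for a' b' \<alpha> \<beta>
  proof -
    have "(a' + b', \<alpha>, \<beta>) \<in> S"
      using that by (auto simp: S_def)
    then show ?thesis
      using \<xi>(2) by (auto simp: \<xi>_eq)
  qed
  have \<gamma>_le: "\<gamma> \<le> w \<bullet> c - m1 * N a - m2 * D b"
    using \<xi>(3) by (simp add: \<xi>_eq)
  \<comment> \<open>\<open>S\<close> is invariant under positive scaling, so a positive value of the
    functional could be scaled past \<open>\<gamma>\<close>.\<close>
  have cone: "w \<bullet> (a' + b') - m1 * \<alpha> - m2 * \<beta> \<le> 0" if "N a' < \<alpha>" "D b' < \<beta>" for a' b' \<alpha> \<beta>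
  proof (rule ccontr)
    let ?v = "w \<bullet> (a' + b') - m1 * \<alpha> - m2 * \<beta>"
    assume "\<not> ?v \<le> 0"
    define k where "k = (\<bar>\<gamma>\<bar> + 1) / ?v"
    have "0 < k"
      using \<open>\<not> ?v \<le> 0\<close> by (simp add: k_def)
    then have "w \<bullet> (k *\<^sub>R a' + k *\<^sub>R b') - m1 * (k * \<alpha>) - m2 * (k * \<beta>) \<le> \<gamma>"
      using that by (intro sep) (auto simp: scaleR dual.scaleR)
    moreover have "w \<bullet> (k *\<^sub>R a' + k *\<^sub>R b') - m1 * (k * \<alpha>) - m2 * (k * \<beta>) = k * ?v"
      by (simp add: inner_add_right algebra_simps)
    moreover have "k * ?v = \<bar>\<gamma>\<bar> + 1"
      using \<open>\<not> ?v \<le> 0\<close> by (simp add: k_def)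
    ultimately show False
      by linarith
  qed
  have small: "\<exists>\<epsilon>>0. m1 * \<epsilon> + m2 * \<epsilon> \<le> e" if "0 < e" for e
  proof -
    define \<epsilon> where "\<epsilon> = e / (\<bar>m1\<bar> + \<bar>m2\<bar> + 1)"
    have "0 < \<epsilon>"
      using \<open>0 < e\<close> by (simp add: \<epsilon>_def add_nonneg_pos)
    moreover have "m1 * \<epsilon> + m2 * \<epsilon> \<le> (\<bar>m1\<bar> + \<bar>m2\<bar> + 1) * \<epsilon>"
      using \<open>0 < \<epsilon>\<close> by (simp flip: distrib_right)
    moreover have "\<bar>m1\<bar> + \<bar>m2\<bar> + 1 \<noteq> 0"
      by linarith
    then have "(\<bar>m1\<bar> + \<bar>m2\<bar> + 1) * \<epsilon> = e"
      by (simp add: \<epsilon>_def)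
    ultimately show ?thesis
      by auto
  qed
  have closed_cone: "w \<bullet> (a' + b') \<le> m1 * N a' + m2 * D b'" for a' b'
  proof (rule field_le_epsilon)
    fix e :: real assume "0 < e"
    then obtain \<epsilon> where "0 < \<epsilon>" "m1 * \<epsilon> + m2 * \<epsilon> \<le> e"
      using small by blast
    moreover from this have "w \<bullet> (a' + b') - m1 * (N a' + \<epsilon>) - m2 * (D b' + \<epsilon>) \<le> 0"
      by (intro cone) auto
    ultimately show "w \<bullet> (a' + b') \<le> m1 * N a' + m2 * D b' + e"
      by (simp add: algebra_simps)
  qed
  have left: "w \<bullet> a' \<le> m1 * N a'" and right: "w \<bullet> b' \<le> m2 * D b'" for a' b'
    using closed_cone[of a' 0] closed_cone[of 0 b'] by auto
  \<comment> \<open>Points of \<open>S\<close> over the origin with small \<epsilon> force 0 \<le>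
    \<gamma>. With this bound, \<open>left\<close> at \<open>a\<close> and \<open>right\<close> at
    \<open>b\<close> must both be equalities.\<close>
  have "m1 * N a + m2 * D b \<le> w \<bullet> c"
  proof -
    have "0 \<le> \<gamma>"
    proof (rule field_le_epsilon)
      fix e :: real assume "0 < e"
      then obtain \<epsilon> where "0 < \<epsilon>" "m1 * \<epsilon> + m2 * \<epsilon> \<le> e"
        using small by blast
      then show "0 \<le> \<gamma> + e"
        using sep[of 0 \<epsilon> 0 \<epsilon>] by simp
    qed
    then show ?thesis
      using \<gamma>_le by linarith
  qed
  then have a: "w \<bullet> a = m1 * N a" and b: "w \<bullet> b = m2 * D b"
    using left[of a] right[of b] by (auto simp: c(1) inner_add_right)
  have m_nonneg: "0 \<le> m1" "0 \<le> m2"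
  proof -
    have "0 \<le> m1 * N a"
      using left[of a] left[of "- a"] by (simp add: uminus)
    then show "0 \<le> m1"
      using c(2) zero_le_mult_iff[of m1 "N a"] by linarith
    have "0 \<le> m2 * D b"
      using right[of b] right[of "- b"] by (simp add: dual.uminus)
    then show "0 \<le> m2"
      using c(3) zero_le_mult_iff[of m2 "D b"] by linarith
  qed
  \<comment> \<open>With \<open>w = 0\<close> both coefficients would vanish, and \<xi> with them.
    Evaluating \<open>left\<close> and \<open>right\<close> at \<open>w\<close> itself then excludes
    \<open>m1 = 0\<close> and \<open>m2 = 0\<close>.\<close>
  have "w \<noteq> 0"
    using a b c(2,3) \<xi>(1) by (auto simp: \<xi>_eq zero_prod_def)
  then have "0 < w \<bullet> w"
    by simp
  then have "m1 \<noteq> 0" "m2 \<noteq> 0"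
    using left[of w] right[of w] by (metis mult_zero_left not_less)+
  then have "0 < m1" "0 < m2"
    using m_nonneg by auto
  \<comment> \<open>Dividing by \<open>m2\<close> normalises the coefficient of \<open>D b\<close>
    to 1, so \<open>m\<close> is \<open>m1 / m2\<close>.\<close>
  have "N ((1 / m2) *\<^sub>R w) \<le> 1"
  proof (rule le_of_inner_le_dual)
    show "v \<bullet> (1 / m2) *\<^sub>R w \<le> D v" for v
      using right[of v] \<open>0 < m2\<close> by (simp add: field_simps inner_commute)
  qed
  moreover have "D ((1 / m2) *\<^sub>R w) \<le> m1 / m2"
  proof (rule dual_le)
    show "(1 / m2) *\<^sub>R w \<bullet> v \<le> m1 / m2 * N v" for v
      using left[of v] \<open>0 < m2\<close> by (simp add: field_simps)
  qed
  moreover have "a \<bullet> (1 / m2) *\<^sub>R w = m1 / m2 * N a" "b \<bullet> (1 / m2) *\<^sub>R w = D b" "0 < m1 / m2"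
    using a b \<open>0 < m1\<close> \<open>0 < m2\<close> by (simp_all add: inner_commute)
  ultimately show ?thesis
    by blast
qed

end

subsection \<open>Slope decompositions\<close>

locale slope_decomposition = norm_dual_pair N for N :: "'a::euclidean_space \<Rightarrow> real" +
  fixes c :: 'a and cs :: "'a list"
  assumes slope_decomp: "slope_decomp N c cs"
begin

abbreviation r :: nat where "r \<equiv> length cs"
abbreviation x :: "nat \<Rightarrow> real" where "x i \<equiv> N (cs ! i)"
abbreviation y :: "nat \<Rightarrow> real" where "y i \<equiv> D (cs ! i)"

lemma c_eq_sum: "c = (\<Sum>i<r. cs ! i)"
  using slope_decomp by (simp add: slope_decomp_def sum_list_sum_nth atLeast0LessThan)

lemma inner_nth: "i \<le> j \<Longrightarrow> j < r \<Longrightarrow> cs ! i \<bullet> cs ! j = x i * y j"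
  using slope_decomp by (simp add: slope_decomp_def)

lemma x_pos: "i < r \<Longrightarrow> 0 < x i"
  and y_pos: "i < r \<Longrightarrow> 0 < y i"
  using slope_decomp by (auto simp: slope_decomp_def pos_iff dual.pos_iff)

text \<open>Every summand has Hoelder equality with the last one, so testing against
  \<open>cs ! (r - 1)\<close> reverses the triangle inequality.\<close>

lemma N_combination:
  assumes "\<And>i. i < r \<Longrightarrow> 0 \<le> \<alpha> i"
  shows "N (\<Sum>i<r. \<alpha> i *\<^sub>R cs ! i) = (\<Sum>i<r. \<alpha> i * x i)"
proof (cases "r = 0")
  case False
  then have r: "r - 1 < r"
    by simp
  have "(\<Sum>i<r. \<alpha> i * x i) * y (r - 1) = (\<Sum>i<r. \<alpha> i *\<^sub>R cs ! i) \<bullet> cs ! (r - 1)"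
    unfolding inner_sum_left sum_distrib_right by (intro sum.cong) (auto simp: inner_nth)
  also have "\<dots> \<le> N (\<Sum>i<r. \<alpha> i *\<^sub>R cs ! i) * y (r - 1)"
    by (rule inner_le')
  finally have "(\<Sum>i<r. \<alpha> i * x i) \<le> N (\<Sum>i<r. \<alpha> i *\<^sub>R cs ! i)"
    using y_pos[OF r] by simp
  moreover have "N (\<Sum>i<r. \<alpha> i *\<^sub>R cs ! i) \<le> (\<Sum>i<r. \<alpha> i * x i)"
    using sum_triangle[of "\<lambda>i. \<alpha> i *\<^sub>R cs ! i" "{..<r}"] assms by (simp add: scaleR)
  ultimately show ?thesis
    by simp
qed simp

text \<open>Dually, the first summand has Hoelder equality with every summand.\<close>

lemma D_combination:
  assumes "\<And>i. i < r \<Longrightarrow> 0 \<le> \<beta> i"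
  shows "D (\<Sum>i<r. \<beta> i *\<^sub>R cs ! i) = (\<Sum>i<r. \<beta> i * y i)"
proof (cases "r = 0")
  case False
  then have r: "0 < r"
    by simp
  have "x 0 * (\<Sum>i<r. \<beta> i * y i) = cs ! 0 \<bullet> (\<Sum>i<r. \<beta> i *\<^sub>R cs ! i)"
    unfolding inner_sum_right sum_distrib_left by (intro sum.cong) (auto simp: inner_nth)
  also have "\<dots> \<le> x 0 * D (\<Sum>i<r. \<beta> i *\<^sub>R cs ! i)"
    by (rule inner_le')
  finally have "(\<Sum>i<r. \<beta> i * y i) \<le> D (\<Sum>i<r. \<beta> i *\<^sub>R cs ! i)"
    using x_pos[OF r] by simp
  moreover have "D (\<Sum>i<r. \<beta> i *\<^sub>R cs ! i) \<le> (\<Sum>i<r. \<beta> i * y i)"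
    using dual.sum_triangle[of "\<lambda>i. \<beta> i *\<^sub>R cs ! i" "{..<r}"] assms by (simp add: dual.scaleR)
  ultimately show ?thesis
    by simp
qed simp

lemma N_c: "N c = (\<Sum>i<r. x i)"
  using N_combination[of "\<lambda>_. 1"] by (simp add: c_eq_sum)

lemma D_c: "D c = (\<Sum>i<r. y i)"
  using D_combination[of "\<lambda>_. 1"] by (simp add: c_eq_sum)

section \<open>The polygonal path through the partial sums\<close>

definition weight :: "nat \<Rightarrow> real \<Rightarrow> nat \<Rightarrow> real" where
  "weight i s j = (if j < i then 1 else if j = i then s else 0)"

definition curve_point :: "nat \<Rightarrow> real \<Rightarrow> 'a" where
  "curve_point i s = (\<Sum>j<r. weight i s j *\<^sub>R cs ! j)"

definition abscissa :: "nat \<Rightarrow> real \<Rightarrow> real" where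
  "abscissa i s = (\<Sum>j<i. x j) + s * x i"

definition ordinate :: "nat \<Rightarrow> real \<Rightarrow> real" where
  "ordinate i s = (1 - s) * (\<Sum>j\<in>{i..<r}. y j) + s * (\<Sum>j\<in>{Suc i..<r}. y j)"

lemma sum_split_at:
  fixes g :: "nat \<Rightarrow> real"
  assumes "i < r"
  shows "(\<Sum>j<r. g j) = (\<Sum>j<i. g j) + g i + (\<Sum>j\<in>{Suc i..<r}. g j)"
  using assms sum.atLeastLessThan_concat[of 0 i r g] sum.atLeast_Suc_lessThan[of i r g]
  by (simp add: atLeast0LessThan)

lemma ordinate_eq:
  assumes "i < r"
  shows "ordinate i s = (1 - s) * y i + (\<Sum>j\<in>{Suc i..<r}. y j)"
  using assms sum.atLeast_Suc_lessThan[of i r y] by (simp add: ordinate_def algebra_simps)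

lemma sum_weight:
  assumes "i < r"
  shows "(\<Sum>j<r. weight i s j * x j) = abscissa i s"
    and "(\<Sum>j<r. (1 - weight i s j) * y j) = ordinate i s"
  using assms by (simp_all add: sum_split_at[OF assms] abscissa_def ordinate_eq weight_def)

text \<open>\<open>weight i s j * (1 - weight i s k)\<close> vanishes for \<open>k < j\<close>, so
  only pairs covered by the slope condition survive in the expanded inner product.\<close>

lemma curve_point_decomp:
  assumes "i < r" "0 \<le> s" "s \<le> 1"
  shows "N (curve_point i s) = abscissa i s"
    and "D (c - curve_point i s) = ordinate i s"
    and "curve_point i s \<bullet> (c - curve_point i s) = N (curve_point i s) * D (c - curve_point i s)"
proof -
  have c_minus: "c - curve_point i s = (\<Sum>j<r. (1 - weight i s j) *\<^sub>R cs ! j)"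
    by (simp add: c_eq_sum curve_point_def scaleR_left_diff_distrib sum_subtractf)
  show N: "N (curve_point i s) = abscissa i s"
    using assms sum_weight(1)[of i s] by (simp add: curve_point_def N_combination weight_def)
  show D: "D (c - curve_point i s) = ordinate i s"
    unfolding c_minus using assms sum_weight(2)[of i s]
    by (subst D_combination) (auto simp: weight_def)
  have weights: "weight i s j * (1 - weight i s k) * (cs ! j \<bullet> cs ! k)
      = weight i s j * x j * ((1 - weight i s k) * y k)" if "j < r" "k < r" for j k
  proof (cases "j \<le> k")
    case True
    then show ?thesis
      using that by (simp add: inner_nth)
  qed (auto simp: weight_def)
  have "curve_point i s \<bullet> (c - curve_point i s)
      = (\<Sum>j<r. \<Sum>k<r. weight i s j * (1 - weight i s k) * (cs ! j \<bullet> cs ! k))"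
    unfolding c_minus unfolding curve_point_def inner_sum_left unfolding inner_sum_right
    by (intro sum.cong refl) (simp add: mult.assoc)
  also have "\<dots> = (\<Sum>j<r. \<Sum>k<r. weight i s j * x j * ((1 - weight i s k) * y k))"
    by (intro sum.cong) (simp_all add: weights)
  also have "\<dots> = abscissa i s * ordinate i s"
    using assms(1) by (simp flip: sum_product add: sum_weight)
  finally show "curve_point i s \<bullet> (c - curve_point i s) = N (curve_point i s) * D (c - curve_point i s)"
    by (simp add: N D)
qed

text \<open>Testing \<open>c - a\<close> against \<open>c\<^sub>i\<close> yields the linear function extending the \<open>i\<close>-th piece of the curve.\<close>

lemma dual_norm_lower_bound:
  assumes "i < r"
  shows "ordinate i s + y i / x i * (abscissa i s - N a) \<le> D (c - a)"
proof -
  have "c \<bullet> cs ! i = (\<Sum>j<r. cs ! j \<bullet> cs ! i)"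
    by (simp add: c_eq_sum inner_sum_left)
  also have "\<dots> = (\<Sum>j<i. cs ! j \<bullet> cs ! i) + cs ! i \<bullet> cs ! i + (\<Sum>j\<in>{Suc i..<r}. cs ! j \<bullet> cs ! i)"
    by (rule sum_split_at[OF assms])
  also have "(\<Sum>j<i. cs ! j \<bullet> cs ! i) = (\<Sum>j<i. x j) * y i"
    using assms by (simp add: sum_distrib_right inner_nth)
  also have "(\<Sum>j\<in>{Suc i..<r}. cs ! j \<bullet> cs ! i) = x i * (\<Sum>j\<in>{Suc i..<r}. y j)"
    unfolding sum_distrib_left by (intro sum.cong) (auto simp: inner_nth inner_commute[of _ "cs ! i"])
  also have "cs ! i \<bullet> cs ! i = x i * y i"
    using assms by (simp add: inner_nth)
  finally have "(\<Sum>j<i. x j) * y i + x i * y i + x i * (\<Sum>j\<in>{Suc i..<r}. y j) = c \<bullet> cs ! i"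
    by simp
  also have "\<dots> \<le> x i * D (c - a) + N a * y i"
    using inner_le[of "c - a" "cs ! i"] inner_le'[of a "cs ! i"] by (simp add: inner_diff_left)
  finally have "x i * (ordinate i s + y i / x i * (abscissa i s - N a)) \<le> x i * D (c - a)"
    using assms x_pos[OF assms]
    by (simp add: ordinate_eq abscissa_def algebra_simps)
  then show ?thesis
    using x_pos[OF assms] by simp
qed

section \<open>The functions f and h along the path, and tightness\<close>

lemma f_YX_abscissa:
  assumes "i < r" "0 \<le> s" "s \<le> 1"
  shows "f_YX N c (abscissa i s) = ordinate i s"
  unfolding f_YX_def
proof (rule cInf_eq_minimum)
  show "ordinate i s \<in> {D (c - a) |a. N a \<le> abscissa i s}"
    using curve_point_decomp[OF assms] by (auto intro!: exI[of _ "curve_point i s"])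
  fix z assume "z \<in> {D (c - a) |a. N a \<le> abscissa i s}"
  then obtain a where a: "z = D (c - a)" "N a \<le> abscissa i s"
    by blast
  then have "0 \<le> y i / x i * (abscissa i s - N a)"
    by simp
  then show "ordinate i s \<le> z"
    using dual_norm_lower_bound[OF assms(1), of s a] a(1) by linarith
qed

lemma alpha_abscissa:
  assumes "i < r" "0 \<le> s" "s \<le> 1"
  shows "alpha_2X N c (abscissa i s) = curve_point i s"
  using alpha_eqI(1)[of c "curve_point i s" "c - curve_point i s"] curve_point_decomp[OF assms] by simp

lemma h_YX_abscissa:
  assumes "i < r" "0 \<le> s" "s \<le> 1"
  shows "h_YX N c (abscissa i s) = ordinate i s"
  using curve_point_decomp[OF assms] by (simp add: h_YX_def alpha_abscissa[OF assms])

lemma abscissa_exists: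
  assumes "0 < r" "0 \<le> t" "t \<le> N c"
  shows "\<exists>i<r. \<exists>s. 0 \<le> s \<and> s \<le> 1 \<and> t = abscissa i s"
proof -
  have "k \<le> r \<Longrightarrow> 0 < k \<Longrightarrow> t \<le> (\<Sum>j<k. x j) \<Longrightarrow>
      \<exists>i<r. \<exists>s. 0 \<le> s \<and> s \<le> 1 \<and> t = abscissa i s" for k
  proof (induction k)
    case (Suc k)
    show ?case
    proof (cases "t < (\<Sum>j<k. x j)")
      case True
      then have "0 < k"
        using assms(2) by (cases k) auto
      then show ?thesis
        using Suc True by simp
    next
      case False
      then have "t = abscissa k ((t - (\<Sum>j<k. x j)) / x k)"
        "0 \<le> (t - (\<Sum>j<k. x j)) / x k" "(t - (\<Sum>j<k. x j)) / x k \<le> 1"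
        using Suc.prems x_pos[of k] by (auto simp: abscissa_def divide_simps)
      then show ?thesis
        using Suc.prems by (intro exI[of _ k]) auto
    qed
  qed simp
  from this[of r] show ?thesis
    using assms by (simp add: N_c)
qed

lemma f_eq_h:
  assumes "0 \<le> t" "t \<le> N c"
  shows "f_YX N c t = h_YX N c t"
proof (cases "r = 0")
  \<comment> \<open>The empty list has no edge to parametrise the point 0, so \<open>c = 0\<close>
    is computed directly.\<close>
  case True
  then have "c = 0"
    using c_eq_sum by simp
  then have "t = N 0"
    using assms by simp
  then have "alpha_2X N c t = 0"
    using alpha_eqI(1)[of 0 0 0] \<open>c = 0\<close> by simp
  moreover have "{D (c - a) |a. N a \<le> t} = {0}"
    using \<open>c = 0\<close> \<open>t = N 0\<close> by auto
  ultimately show ?thesis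
    using \<open>c = 0\<close> by (simp add: f_YX_def h_YX_def)
next
  case False
  then obtain i s where "i < r" "0 \<le> s" "s \<le> 1" "t = abscissa i s"
    using abscissa_exists[OF _ assms] by auto
  then show ?thesis
    by (simp add: f_YX_abscissa h_YX_abscissa)
qed

text \<open>Uniqueness of nearest points puts \<open>a\<close> on the path. The supporting line
  there has positive \<open>y i / x i\<close>, so a smaller \<open>N a'\<close> strictly raises the
  lower bound for \<open>D b'\<close>.\<close>

lemma tight: "tight N c"
  unfolding tight_def
proof (intro allI impI)
  fix a b assume "PQ_decomp N norm c a b"
  then have ab: "c = a + b" "a \<bullet> b = N a * D b"
    by (auto simp: X2_decomp_iff)
  have "N a \<le> N c"
    using \<open>PQ_decomp N norm c a b\<close> by (rule X2_decomp_le)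
  show "PQ_decomp N D c a b"
    unfolding PQ_decomp_def
  proof (intro conjI allI impI)
    fix a' b' assume c: "c = a' + b'"
    show "N a < N a' \<or> D b < D b' \<or> N a' = N a \<and> D b' = D b"
    proof (cases "r = 0")
      case True
      then have "c = 0"
        using c_eq_sum by simp
      then have "a = 0"
        using \<open>N a \<le> N c\<close> nonneg[of a] by (metis eq_0_iff order_antisym)
      then show ?thesis
        using c ab \<open>c = 0\<close> nonneg[of a'] pos_iff[of a'] by auto
    next
      case False
      then obtain i s where ix: "i < r" "0 \<le> s" "s \<le> 1" "N a = abscissa i s"
        using abscissa_exists[of "N a"] \<open>N a \<le> N c\<close> by auto
      have "a = curve_point i s"
        using alpha_eqI(1)[OF ab] alpha_abscissa[OF ix(1-3)] ix(4) by simp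
      then have b: "D b = ordinate i s"
        using curve_point_decomp(2)[OF ix(1-3)] ab(1) by simp
      have "D b + y i / x i * (N a - N a') \<le> D b'"
        using dual_norm_lower_bound[OF ix(1), of s a'] c b ix(4) by simp
      moreover have "0 < y i / x i * (N a - N a')" if "N a' < N a"
        using that ix(1) by (simp add: x_pos y_pos)
      moreover have "y i / x i * (N a - N a') = 0" if "N a' = N a"
        using that by simp
      ultimately show ?thesis
        by linarith
    qed
  qed (rule ab(1))
qed

end

subsection \<open>Tight vectors\<close>

text \<open>The bound is summed over n^2 equal steps. \<open>AM_GM\<close> trades the square root of
  a drop of \<open>m\<close> for the drop itself, which telescopes; the total error
  \<open>K / n\<close> tends to 0.\<close>

lemma subadditive_interval_nonpos:
  fixes F :: "real \<Rightarrow> real \<Rightarrow> real" and m :: "real \<Rightarrow> real"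
  assumes "p < q" "0 \<le> C"
    and subadditive: "\<And>s t u. p \<le> s \<Longrightarrow> s < t \<Longrightarrow> t < u \<Longrightarrow> u \<le> q \<Longrightarrow> F s u \<le> F s t + F t u"
    and bound: "\<And>s t. p \<le> s \<Longrightarrow> s < t \<Longrightarrow> t \<le> q \<Longrightarrow> F s t \<le> C * ((t - s) * sqrt (m s - m t))"
    and antimono: "\<And>s t. p \<le> s \<Longrightarrow> s < t \<Longrightarrow> t \<le> q \<Longrightarrow> m t \<le> m s"
  shows "F p q \<le> 0"
proof -
  define K where "K = C * (q - p) * (1 + (m p - m q))"
  have "F p q \<le> K / real n" if "0 < n" for n :: nat
  proof -
    have AM_GM: "sqrt \<Delta> \<le> 1 / n + n * \<Delta>" if "0 \<le> \<Delta>" for \<Delta> :: real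
    proof -
      have "sqrt (n * \<Delta> * (1 / n)) \<le> (n * \<Delta> + 1 / n) / 2"
        using that by (intro arith_geo_mean_sqrt) auto
      moreover have "0 \<le> 1 / n + n * \<Delta>"
        using that by simp
      ultimately show ?thesis
        using \<open>0 < n\<close> by simp
    qed
    define \<delta> where "\<delta> = (q - p) / (real n)\<^sup>2"
    define t where "t k = p + real k * \<delta>" for k :: nat
    have \<delta>: "0 < \<delta>"
      using assms(1) \<open>0 < n\<close> by (simp add: \<delta>_def)
    have end_point: "t (n\<^sup>2) = q"
      using \<open>0 < n\<close> by (simp add: t_def \<delta>_def)
    have t_le: "t k \<le> q" if "k \<le> n\<^sup>2" for k
    proof -
      have "real k * \<delta> \<le> real (n\<^sup>2) * \<delta>"
        using that \<delta> by (intro mult_right_mono) (auto simp only: of_nat_le_iff)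
      then show ?thesis
        using end_point by (simp add: t_def)
    qed
    have t_Suc: "t (Suc k) = t k + \<delta>" for k
      by (simp add: t_def algebra_simps)
    have step: "F (t k) (t (Suc k)) \<le> C * \<delta> * (1 / n + n * (m (t k) - m (t (Suc k))))"
      if "Suc k \<le> n\<^sup>2" for k
    proof -
      have k: "p \<le> t k" "t k < t (Suc k)" "t (Suc k) \<le> q"
        using \<delta> t_le[OF that] by (auto simp: t_def)
      have "F (t k) (t (Suc k)) \<le> C * (\<delta> * sqrt (m (t k) - m (t (Suc k))))"
        using bound[OF k] by (simp add: t_Suc)
      also have "\<dots> \<le> C * (\<delta> * (1 / n + n * (m (t k) - m (t (Suc k)))))"
        using antimono[OF k] \<delta> assms(2) by (intro mult_left_mono AM_GM) auto
      finally show ?thesis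
        by (simp add: mult.assoc)
    qed
    \<comment> \<open>The induction starts at one step because the assumptions concern only
      intervals of positive length and say nothing about \<open>F p p\<close>.\<close>
    have "F p (t (Suc k)) \<le> C * \<delta> * (real (Suc k) / n + n * (m p - m (t (Suc k))))" if "Suc k \<le> n\<^sup>2" for k
      using that
    proof (induction k)
      case 0
      then show ?case
        using step[of 0] by (simp add: t_def)
    next
      case (Suc k)
      have "F p (t (Suc (Suc k))) \<le> F p (t (Suc k)) + F (t (Suc k)) (t (Suc (Suc k)))"
        using \<delta> t_le[OF Suc.prems] by (intro subadditive) (auto simp: t_def)
      also have "\<dots> \<le> C * \<delta> * (real (Suc k) / n + n * (m p - m (t (Suc k))))
          + C * \<delta> * (1 / n + n * (m (t (Suc k)) - m (t (Suc (Suc k)))))"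
        using Suc.prems by (intro add_mono Suc.IH step) auto
      also have "\<dots> = C * \<delta> * (real (Suc (Suc k)) / n + n * (m p - m (t (Suc (Suc k)))))"
        by (simp add: algebra_simps add_divide_distrib)
      finally show ?case .
    qed
    from this[of "n\<^sup>2 - 1"] have "F p q \<le> C * \<delta> * (real (n\<^sup>2) / n + n * (m p - m q))"
      using \<open>0 < n\<close> end_point by simp
    also have "\<dots> = K / n"
      using \<open>0 < n\<close> by (simp add: K_def \<delta>_def field_simps power2_eq_square)
    finally show ?thesis .
  qed
  then have "\<forall>n\<ge>1. F p q \<le> K / real n"
    by simp
  then show ?thesis
    by (intro LIMSEQ_le_const[OF lim_const_over_n]) auto
qed

section \<open>The path of nearest points of a tight vector\<close>

locale tight_vector = norm_dual_pair N for N :: "'a::euclidean_space \<Rightarrow> real" +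
  fixes c :: 'a
  assumes tight: "tight N c"
begin

definition a :: "real \<Rightarrow> 'a" where "a t = alpha_2X N c t"
abbreviation b :: "real \<Rightarrow> 'a" where "b t \<equiv> c - a t"
abbreviation h :: "real \<Rightarrow> real" where "h t \<equiv> D (b t)"

lemma N_a: "0 \<le> t \<Longrightarrow> t \<le> N c \<Longrightarrow> N (a t) = t"
  and inner_a_b: "0 \<le> t \<Longrightarrow> t \<le> N c \<Longrightarrow> a t \<bullet> b t = t * h t"
proof -
  have *: "N (a t) = t \<and> a t \<bullet> b t = t * h t" if t: "0 \<le> t" "t \<le> N c"
  proof -
    obtain p where p: "N p = t" "p \<bullet> (c - p) = t * D (c - p)"
      using projection_exists[OF t] by blast
    then have "a t = p"
      using alpha_eqI(1)[of c p "c - p"] by (simp add: a_def)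
    then show ?thesis
      using p by simp
  qed
  show "0 \<le> t \<Longrightarrow> t \<le> N c \<Longrightarrow> N (a t) = t" "0 \<le> t \<Longrightarrow> t \<le> N c \<Longrightarrow> a t \<bullet> b t = t * h t"
    using * by auto
qed

lemma a_0 [simp]: "a 0 = 0"
  using N_a[of 0] by simp

lemma a_end [simp]: "a (N c) = c"
  using alpha_eqI(1)[of c c 0] by (simp add: a_def)

text \<open>The only place where tightness itself enters.\<close>

lemma pareto:
  assumes "0 \<le> t" "t \<le> N c" "c = a' + b'" "N a' \<le> t"
  shows "h t < D b' \<or> N a' = t \<and> D b' = h t"
proof -
  have "PQ_decomp N norm c (a t) (b t)"
    using assms(1,2) by (simp add: X2_decomp_iff N_a inner_a_b)
  then have "PQ_decomp N D c (a t) (b t)"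
    using tight by (simp add: tight_def)
  then show ?thesis
    using assms N_a[of t] unfolding PQ_decomp_def by (metis not_less)
qed

lemma h_strict_antimono:
  assumes "0 \<le> s" "s < t" "t \<le> N c"
  shows "h t < h s"
  using pareto[of t "a s" "b s"] N_a[of s] assms by simp

lemma h_antimono: "0 \<le> s \<Longrightarrow> s \<le> t \<Longrightarrow> t \<le> N c \<Longrightarrow> h t \<le> h s"
  using h_strict_antimono[of s t] by (cases "s = t") auto

text \<open>An increment of \<open>a\<close> is the negative of that of \<open>b\<close>, so the
  square expands into pairings of \<open>a\<close> with \<open>b\<close>: the diagonal ones are
  exact, the mixed ones are bounded by Hoelder.\<close>

lemma a_holder:
  assumes "0 \<le> s" "s \<le> t" "t \<le> N c"
  shows "(norm (a t - a s))\<^sup>2 \<le> (t - s) * (h s - h t)"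
proof -
  have "a t - a s = b s - b t"
    by simp
  then have "(norm (a t - a s))\<^sup>2 = (a t - a s) \<bullet> (b s - b t)"
    by (metis power2_norm_eq_inner)
  also have "\<dots> = a t \<bullet> b s + a s \<bullet> b t - a t \<bullet> b t - a s \<bullet> b s"
    by (simp only: inner_diff_left inner_diff_right)
  also have "\<dots> \<le> t * h s + s * h t - t * h t - s * h s"
    using inner_le'[of "a t" "b s"] inner_le'[of "a s" "b t"] assms
    by (simp add: N_a inner_a_b)
  finally show ?thesis
    by (simp add: algebra_simps)
qed

section \<open>Multipliers and the slope of h\<close>

definition multiplier :: "real \<Rightarrow> real \<Rightarrow> 'a \<Rightarrow> bool" where
  "multiplier t m w \<longleftrightarrow> 0 < m \<and> N w \<le> 1 \<and> D w \<le> m \<and> a t \<bullet> w = m * t \<and> b t \<bullet> w = h t"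

definition m :: "real \<Rightarrow> real" where "m t = (SOME m. \<exists>w. multiplier t m w)"
definition w :: "real \<Rightarrow> 'a" where "w t = (SOME w. multiplier t (m t) w)"

lemma multiplier:
  assumes "0 < t" "t < N c"
  shows "multiplier t (m t) (w t)"
proof -
  have h_pos: "0 < h t"
    using h_strict_antimono[of t "N c"] assms by simp
  have N_eq: "N (a t) = t"
    using assms by (simp add: N_a)
  have "\<exists>m w. 0 < m \<and> N w \<le> 1 \<and> D w \<le> m \<and> a t \<bullet> w = m * N (a t) \<and> b t \<bullet> w = h t"
  proof (rule pareto_multiplier[of c])
    show False if "c = a' + b'" "N a' < N (a t)" "D b' < h t" for a' b'
      using pareto[OF _ _ that(1), of t] that(2,3) assms by (simp add: N_eq)
  qed (use assms h_pos N_eq in auto)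
  then have "\<exists>m w. multiplier t m w"
    using assms by (simp add: multiplier_def N_a)
  then have "\<exists>w. multiplier t (m t) w"
    unfolding m_def by (rule someI_ex)
  then show ?thesis
    unfolding w_def by (rule someI_ex)
qed

lemma m_pos: "0 < t \<Longrightarrow> t < N c \<Longrightarrow> 0 < m t"
  and N_w: "0 < t \<Longrightarrow> t < N c \<Longrightarrow> N (w t) \<le> 1"
  and D_w: "0 < t \<Longrightarrow> t < N c \<Longrightarrow> D (w t) \<le> m t"
  and inner_a_w: "0 < t \<Longrightarrow> t < N c \<Longrightarrow> a t \<bullet> w t = m t * t"
  and inner_b_w: "0 < t \<Longrightarrow> t < N c \<Longrightarrow> b t \<bullet> w t = h t"
  using multiplier by (auto simp: multiplier_def)

lemma norm_w_le:
  assumes "0 < t" "t < N c"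
  shows "(norm (w t))\<^sup>2 \<le> m t"
proof -
  have "N (w t) * D (w t) \<le> 1 * m t"
    using assms by (intro mult_mono N_w D_w) auto
  then show ?thesis
    using norm_square_le[of "w t"] by linarith
qed

lemma inner_a_w_le:
  assumes "0 < t" "t < N c" "0 \<le> s" "s \<le> N c"
  shows "a s \<bullet> w t \<le> m t * s"
proof -
  have "s * D (w t) \<le> s * m t"
    using assms by (intro mult_left_mono D_w) auto
  then show ?thesis
    using inner_le'[of "a s" "w t"] assms by (simp add: N_a mult.commute)
qed

lemma inner_b_w_le:
  assumes "0 < t" "t < N c"
  shows "b s \<bullet> w t \<le> h s"
proof -
  have "N (w t) * h s \<le> 1 * h s"
    using assms by (intro mult_right_mono N_w) auto
  then show ?thesis
    using inner_le[of "b s" "w t"] by simp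
qed

lemma inner_increment_left:
  assumes "0 < t" "t < N c" "0 \<le> s" "s \<le> N c"
  shows "m t * (t - s) \<le> (a t - a s) \<bullet> w t"
  using inner_a_w_le[OF assms] inner_a_w[OF assms(1,2)]
  by (simp add: inner_diff_left right_diff_distrib)

lemma inner_increment_right:
  assumes "0 < t" "t < N c"
  shows "h t - h s \<le> (a s - a t) \<bullet> w t"
proof -
  have "(a s - a t) \<bullet> w t = b t \<bullet> w t - b s \<bullet> w t"
    by (simp add: inner_diff_left)
  then show ?thesis
    using inner_b_w_le[OF assms, of s] inner_b_w[OF assms] by simp
qed

text \<open>\<open>w t\<close> is tested twice on one increment, from the side of \<open>a\<close>
  and from that of \<open>b\<close>. The outcome puts \<open>h\<close> above the line of slope
  \<open>- m t\<close> through \<open>(t, h t)\<close>.\<close>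

lemma subgradient:
  assumes "0 < t" "t < N c" "0 \<le> s" "s \<le> N c"
  shows "m t * (t - s) \<le> h s - h t"
proof -
  have "(a s - a t) \<bullet> w t = - ((a t - a s) \<bullet> w t)"
    by (simp add: inner_diff_left)
  then have "m t * (t - s) \<le> - (h t - h s)"
    using inner_increment_left[OF assms] inner_increment_right[OF assms(1,2), of s] by linarith
  then show ?thesis
    by simp
qed

lemma m_antimono:
  assumes "0 < s" "s < t" "t < N c"
  shows "m t \<le> m s"
proof -
  have "m t * (t - s) \<le> m s * (t - s)"
    using subgradient[of t s] subgradient[of s t] assms by (simp add: algebra_simps)
  then show ?thesis
    using assms by simp
qed

text \<open>The three terms of the expanded square are controlled by \<open>a_holder\<close>,
  \<open>inner_increment_left\<close> and \<open>norm_w_le\<close>; what remains is proportional to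
  the drop of \<open>m\<close>.\<close>

lemma increment_approx:
  assumes "0 < s" "s < t" "t < N c"
  shows "norm (a t - a s - (t - s) *\<^sub>R w t) \<le> (t - s) * sqrt (m s - m t)"
proof -
  have "(norm (a t - a s - (t - s) *\<^sub>R w t))\<^sup>2
      = (norm (a t - a s))\<^sup>2 - 2 * (t - s) * ((a t - a s) \<bullet> w t) + (t - s)\<^sup>2 * (norm (w t))\<^sup>2"
    unfolding power2_norm_eq_inner
    by (simp add: inner_diff_left inner_diff_right inner_commute power2_eq_square algebra_simps)
  also have "\<dots> \<le> (t - s) * (h s - h t) - 2 * (t - s) * (m t * (t - s)) + (t - s)\<^sup>2 * m t"
    using assms a_holder[of s t] inner_increment_left[of t s] norm_w_le[of t]
    by (intro add_mono diff_mono mult_left_mono) auto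
  also have "\<dots> = (t - s) * (h s - h t) - (t - s)\<^sup>2 * m t"
    by (simp add: power2_eq_square)
  also have "\<dots> \<le> (t - s) * (m s * (t - s)) - (t - s)\<^sup>2 * m t"
    using subgradient[of s t] assms
    by (intro diff_right_mono mult_left_mono) (auto simp: algebra_simps)
  also have "\<dots> = (t - s)\<^sup>2 * (m s - m t)"
    by (simp add: power2_eq_square algebra_simps)
  finally have "norm (a t - a s - (t - s) *\<^sub>R w t) \<le> sqrt ((t - s)\<^sup>2 * (m s - m t))"
    by (rule real_le_rsqrt)
  then show ?thesis
    using assms by (simp add: real_sqrt_mult)
qed

text \<open>The excess of the norm of an increment over the claimed bound is subadditive, and
  \<open>increment_approx\<close> gives the local estimate required by
  \<open>subadditive_interval_nonpos\<close>.\<close>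

lemma increment_le_interior:
  assumes "0 < s" "s < t" "t < N c"
  shows "N (a t - a s) \<le> t - s"
    and "D (a t - a s) \<le> h s - h t"
proof -
  obtain C where C: "C > 0" "\<And>v. N v \<le> C * norm v"
    using bounded_by_norm by blast
  have "N (a t - a s) - (t - s) \<le> 0"
  proof (rule subadditive_interval_nonpos[where F = "\<lambda>s t. N (a t - a s) - (t - s)" and m = m and C = C])
    show "N (a u - a s') - (u - s') \<le> N (a t' - a s') - (t' - s') + (N (a u - a t') - (u - t'))" for s' t' u
      using triangle[of "a t' - a s'" "a u - a t'"] by simp
    fix s' t' assume *: "s \<le> s'" "s' < t'" "t' \<le> t"
    have "N (a t' - a s') \<le> N ((t' - s') *\<^sub>R w t') + N (a t' - a s' - (t' - s') *\<^sub>R w t')"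
      using triangle[of "(t' - s') *\<^sub>R w t'" "a t' - a s' - (t' - s') *\<^sub>R w t'"] by simp
    also have "\<dots> \<le> (t' - s') * 1 + C * ((t' - s') * sqrt (m s' - m t'))"
    proof (rule add_mono)
      show "N ((t' - s') *\<^sub>R w t') \<le> (t' - s') * 1"
        unfolding scaleR using * assms N_w[of t'] by (intro mult_mono) auto
      show "N (a t' - a s' - (t' - s') *\<^sub>R w t') \<le> C * ((t' - s') * sqrt (m s' - m t'))"
        using * assms C(1) increment_approx[of s' t']
        by (intro order.trans[OF C(2)] mult_left_mono) auto
    qed
    finally show "N (a t' - a s') - (t' - s') \<le> C * ((t' - s') * sqrt (m s' - m t'))"
      by simp
    show "m t' \<le> m s'"
      using * assms by (intro m_antimono) auto
  qed (use assms C in auto)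
  then show "N (a t - a s) \<le> t - s"
    by simp
next
  obtain C where C: "C > 0" "\<And>v. D v \<le> C * norm v"
    using dual.bounded_by_norm by blast
  have "D (a t - a s) - (h s - h t) \<le> 0"
  proof (rule subadditive_interval_nonpos[where F = "\<lambda>s t. D (a t - a s) - (h s - h t)" and m = m and C = C])
    show "D (a u - a s') - (h s' - h u) \<le> D (a t' - a s') - (h s' - h t') + (D (a u - a t') - (h t' - h u))" for s' t' u
      using dual.triangle[of "a t' - a s'" "a u - a t'"] by simp
    fix s' t' assume *: "s \<le> s'" "s' < t'" "t' \<le> t"
    have "D (a t' - a s') \<le> D ((t' - s') *\<^sub>R w t') + D (a t' - a s' - (t' - s') *\<^sub>R w t')"
      using dual.triangle[of "(t' - s') *\<^sub>R w t'" "a t' - a s' - (t' - s') *\<^sub>R w t'"] by simp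
    also have "\<dots> \<le> (t' - s') * m t' + C * ((t' - s') * sqrt (m s' - m t'))"
    proof (rule add_mono)
      show "D ((t' - s') *\<^sub>R w t') \<le> (t' - s') * m t'"
        unfolding dual.scaleR using * assms D_w[of t'] by (intro mult_mono) auto
      show "D (a t' - a s' - (t' - s') *\<^sub>R w t') \<le> C * ((t' - s') * sqrt (m s' - m t'))"
        using * assms C(1) increment_approx[of s' t']
        by (intro order.trans[OF C(2)] mult_left_mono) auto
    qed
    also have "(t' - s') * m t' \<le> h s' - h t'"
      using subgradient[of t' s'] * assms by (simp add: mult.commute)
    finally show "D (a t' - a s') - (h s' - h t') \<le> C * ((t' - s') * sqrt (m s' - m t'))"
      by simp
    show "m t' \<le> m s'"
      using * assms by (intro m_antimono) auto
  qed (use assms C in auto)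
  then show "D (a t - a s) \<le> h s - h t"
    by simp
qed

section \<open>Continuity and exact norms of increments\<close>

lemma continuous_a: "continuous_on {0..N c} a"
  unfolding continuous_on_iff
proof (intro ballI allI impI)
  fix t e :: real assume t: "t \<in> {0..N c}" and "0 < e"
  \<comment> \<open>The summand 1 keeps the denominator positive when \<open>c = 0\<close>.\<close>
  define \<delta> where "\<delta> = e\<^sup>2 / (h 0 + 1)"
  have h0: "0 < h 0 + 1"
    using dual.nonneg[of "b 0"] by linarith
  have close: "norm (a v - a u) < e" if "0 \<le> u" "u \<le> v" "v \<le> N c" "v - u < \<delta>" for u v
  proof -
    have "(norm (a v - a u))\<^sup>2 \<le> (v - u) * (h u - h v)"
      using that by (intro a_holder)
    also have "\<dots> \<le> (v - u) * (h 0 + 1)"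
      using that h_antimono[of 0 u] dual.nonneg[of "b v"] by (intro mult_left_mono) linarith+
    also have "\<dots> < e\<^sup>2"
      using that(4) h0 by (simp add: \<delta>_def field_simps)
    finally show ?thesis
      using \<open>0 < e\<close> by (simp add: power_less_imp_less_base)
  qed
  have "dist (a s) (a t) < e" if "s \<in> {0..N c}" "dist s t < \<delta>" for s
    using close[of s t] close[of t s] that t
    by (cases "s \<le> t") (auto simp: dist_norm norm_minus_commute)
  moreover have "0 < \<delta>"
    using h0 \<open>0 < e\<close> by (simp add: \<delta>_def)
  ultimately show "\<exists>\<delta>>0. \<forall>s\<in>{0..N c}. dist s t < \<delta> \<longrightarrow> dist (a s) (a t) < e"
    by blast
qed

lemma continuous_N_increment: "continuous_on {0..N c} (\<lambda>t. N (a t - v))"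
  by (rule continuous_on_compose2[OF continuous[of UNIV]])
    (auto intro!: continuous_intros continuous_a)

lemma continuous_D_increment: "continuous_on {0..N c} (\<lambda>t. D (a t - v))"
  by (rule continuous_on_compose2[OF dual.continuous[of UNIV]])
    (auto intro!: continuous_intros continuous_a)

lemma continuous_h: "continuous_on {0..N c} h"
  by (rule continuous_on_compose2[OF dual.continuous[of UNIV]])
    (auto intro!: continuous_intros continuous_a)

text \<open>The upper bounds extend from the open interval by continuity; the lower bounds are
  reverse triangle inequalities.\<close>

lemma increment:
  assumes "0 \<le> s" "s \<le> t" "t \<le> N c"
  shows "N (a t - a s) = t - s"
    and "D (a t - a s) = h s - h t"
proof -
  have "N (a t - a s) \<le> t - s \<and> D (a t - a s) \<le> h s - h t"
  proof (cases "s = t")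
    case False
    then have "s < t"
      using assms by simp
    \<comment> \<open>The right end is first allowed to reach \<open>N c\<close> while the left end
      stays positive; afterwards the left end may reach 0.\<close>
    have interior: "N (a t - a s) - (t - s) \<le> 0 \<and> D (a t - a s) - (h s - h t) \<le> 0"
      if s: "0 < s" "s < t" "t \<le> N c" for s t
    proof -
      have t: "t \<in> closure {s<..<N c}" and sub: "closure {s<..<N c} \<subseteq> {0..N c}"
        using s by (auto simp: closure_greaterThanLessThan)
      have "N (a t - a s) - (t - s) \<le> 0"
        using s increment_le_interior(1)[OF s(1)]
        by (intro continuous_le_on_closure[OF _ t, of "\<lambda>t. N (a t - a s) - (t - s)"]
            continuous_intros continuous_on_subset[OF continuous_N_increment sub]) auto
      moreover have "D (a t - a s) - (h s - h t) \<le> 0"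
        using s increment_le_interior(2)[OF s(1)]
        by (intro continuous_le_on_closure[OF _ t, of "\<lambda>t. D (a t - a s) - (h s - h t)"]
            continuous_intros continuous_on_subset[OF continuous_D_increment sub]
            continuous_on_subset[OF continuous_h sub]) auto
      ultimately show ?thesis
        by simp
    qed
    have s: "s \<in> closure {0<..<t}" and sub: "closure {0<..<t} \<subseteq> {0..N c}"
      using assms \<open>s < t\<close> by (auto simp: closure_greaterThanLessThan)
    have "N (a s - a t) - (t - s) \<le> 0"
      using interior assms(3) uminus[of "a t - a _"]
      by (intro continuous_le_on_closure[OF _ s, of "\<lambda>s. N (a s - a t) - (t - s)"]
          continuous_intros continuous_on_subset[OF continuous_N_increment sub]) auto
    moreover have "D (a s - a t) - (h s - h t) \<le> 0"
      using interior assms(3) dual.uminus[of "a t - a _"]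
      by (intro continuous_le_on_closure[OF _ s, of "\<lambda>s. D (a s - a t) - (h s - h t)"]
          continuous_intros continuous_on_subset[OF continuous_D_increment sub]
          continuous_on_subset[OF continuous_h sub]) auto
    ultimately show ?thesis
      using uminus[of "a t - a s"] dual.uminus[of "a t - a s"] by simp
  qed simp
  moreover have "t - s \<le> N (a t - a s)"
    using diff_triangle[of "a t" "a s"] assms by (simp add: N_a)
  moreover have "h s - h t \<le> D (a t - a s)"
    using dual.diff_triangle[of "b s" "b t"] by simp
  ultimately show "N (a t - a s) = t - s" "D (a t - a s) = h s - h t"
    by auto
qed

text \<open>Expanding \<open>a u \<bullet> b u\<close> along \<open>a s + (a t - a s) + (a u - a t)\<close> and \<open>(b u - b v) + b v\<close>, every
  term is at most a product of norms, and these products add up to \<open>u * h u = a u \<bullet> b u\<close>.\<close>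

lemma inner_increments:
  assumes "0 \<le> s" "s \<le> t" "t \<le> u" "u \<le> v" "v \<le> N c"
  shows "(a t - a s) \<bullet> (a v - a u) = (t - s) * (h u - h v)"
proof (rule antisym)
  let ?p = "a t - a s" and ?p' = "a u - a t" and ?q = "a v - a u"
  have norms: "N (a s) = s" "N ?p = t - s" "N ?p' = u - t" "D ?q = h u - h v"
    using assms by (simp_all add: N_a increment)
  show "?p \<bullet> ?q \<le> (t - s) * (h u - h v)"
    using inner_le'[of ?p ?q] by (simp add: norms)
  have "u * h u = (a s + ?p + ?p') \<bullet> (?q + b v)"
    using assms inner_a_b[of u] by simp
  also have "\<dots> = ?p \<bullet> ?q + ?p \<bullet> b v + (a s \<bullet> ?q + a s \<bullet> b v + ?p' \<bullet> ?q + ?p' \<bullet> b v)"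
    by (simp only: inner_add_left inner_add_right)
  also have "\<dots> \<le> ?p \<bullet> ?q + (t - s) * h v
      + (s * (h u - h v) + s * h v + (u - t) * (h u - h v) + (u - t) * h v)"
    using inner_le'[of ?p "b v"] inner_le'[of "a s" ?q] inner_le'[of "a s" "b v"]
      inner_le'[of ?p' ?q] inner_le'[of ?p' "b v"]
    unfolding norms by (intro add_mono) auto
  finally show "(t - s) * (h u - h v) \<le> ?p \<bullet> ?q"
    by (simp add: algebra_simps)
qed

text \<open>As \<open>N (a v - a s) = v - s\<close> and \<open>D (a v - a s) = h s - h v\<close>, this is the diagonal case of the slope condition.\<close>

definition straight :: "real \<Rightarrow> real \<Rightarrow> bool" where
  "straight s v \<longleftrightarrow> (norm (a v - a s))\<^sup>2 = (v - s) * (h s - h v)"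

section \<open>Chords of h, straight pieces and kinks\<close>

lemma equal_slopes_of_chord:
  assumes "0 \<le> s" "s < z" "z < v" "v \<le> N c"
    and chord: "(h s - h z) * (v - z) \<le> (h z - h v) * (z - s)"
  shows "h s - h z = m z * (z - s)" and "h z - h v = m z * (v - z)"
proof -
  have z: "0 < z" "z < N c"
    using assms by auto
  \<comment> \<open>The subgradient puts \<open>m z\<close> between the rates of decrease of
    \<open>h\<close> right and left of \<open>z\<close>; \<open>chord\<close> is the opposite
    comparison, so all three agree.\<close>
  have sub: "m z * (z - s) \<le> h s - h z" "h z - h v \<le> m z * (v - z)"
    using subgradient[OF z, of s] subgradient[OF z, of v] assms by (auto simp: algebra_simps)
  have "m z * (z - s) * (v - z) \<le> (h z - h v) * (z - s)"
    using sub(1) chord assms(3) by (smt (verit) mult_right_mono)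
  then have "(m z * (v - z)) * (z - s) \<le> (h z - h v) * (z - s)"
    by (simp add: algebra_simps)
  then show right: "h z - h v = m z * (v - z)"
    using sub(2) assms(2) by simp
  have "(h s - h z) * (v - z) \<le> (m z * (z - s)) * (v - z)"
    using chord unfolding right by (simp add: algebra_simps)
  then show "h s - h z = m z * (z - s)"
    using sub(1) assms(3) by simp
qed

text \<open>With equal slopes on both sides, \<open>w z\<close> pairs with the whole increment to at
  least \<open>m z * (v - s)\<close>. Cauchy-Schwarz and \<open>norm_w_le\<close> then make the
  increment long enough to attain the bound of \<open>a_holder\<close>.\<close>

lemma straight_of_chord:
  assumes "0 \<le> s" "s < z" "z < v" "v \<le> N c"
    and chord: "(h s - h z) * (v - z) \<le> (h z - h v) * (z - s)"
  shows "straight s v"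
proof -
  have z: "0 < z" "z < N c"
    using assms by auto
  have left: "h s - h z = m z * (z - s)" and right: "h z - h v = m z * (v - z)"
    using equal_slopes_of_chord[of s z v] assms chord by auto
  have total: "h s - h v = m z * (v - s)"
    using left right by (simp add: algebra_simps)
  have "m z * (v - s) \<le> (a v - a s) \<bullet> w z"
  proof -
    have "(a v - a s) \<bullet> w z = (a z - a s) \<bullet> w z + (a v - a z) \<bullet> w z"
      by (simp add: inner_diff_left)
    then show ?thesis
      using inner_increment_left[OF z, of s] inner_increment_right[OF z, of v] assms right
      by (simp add: algebra_simps)
  qed
  also have "\<dots> \<le> norm (a v - a s) * norm (w z)"
    by (rule norm_cauchy_schwarz)
  finally have "(m z * (v - s))\<^sup>2 \<le> (norm (a v - a s) * norm (w z))\<^sup>2"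
    using assms m_pos[OF z] by (intro power_mono) auto
  also have "\<dots> \<le> (norm (a v - a s))\<^sup>2 * m z"
    using norm_w_le[OF z] by (simp add: power_mult_distrib mult_left_mono)
  finally have "m z * (m z * (v - s)\<^sup>2) \<le> m z * (norm (a v - a s))\<^sup>2"
    by (simp add: power_mult_distrib power2_eq_square mult_ac)
  then have "m z * (v - s)\<^sup>2 \<le> (norm (a v - a s))\<^sup>2"
    using m_pos[OF z] by simp
  then have "(v - s) * (h s - h v) \<le> (norm (a v - a s))\<^sup>2"
    by (simp add: total power2_eq_square mult_ac)
  then show ?thesis
    using a_holder[of s v] assms by (simp add: straight_def)
qed

text \<open>When the increment is split at \<open>z\<close>, the cross term is exact by
  \<open>inner_increments\<close> and the squares are bounded by \<open>a_holder\<close>.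
  Straightness therefore leaves \<open>h\<close> no bend at \<open>z\<close>.\<close>

lemma slope_of_straight:
  assumes "straight s v" "0 \<le> s" "s < z" "z < v" "v \<le> N c"
  shows "m z = (h s - h v) / (v - s)"
proof -
  have "a v - a s = (a z - a s) + (a v - a z)"
    by simp
  then have "(norm (a v - a s))\<^sup>2
      = (norm (a z - a s))\<^sup>2 + 2 * ((a z - a s) \<bullet> (a v - a z)) + (norm (a v - a z))\<^sup>2"
    unfolding power2_norm_eq_inner by (simp only: inner_add_left inner_add_right inner_commute)
  also have "\<dots> \<le> (z - s) * (h s - h z) + 2 * ((z - s) * (h z - h v)) + (v - z) * (h z - h v)"
    using a_holder[of s z] a_holder[of z v] inner_increments[of s z z v] assms by simp
  finally have chord: "(h s - h z) * (v - z) \<le> (h z - h v) * (z - s)"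
    using assms(1) by (simp add: straight_def algebra_simps)
  have left: "h s - h z = m z * (z - s)" and right: "h z - h v = m z * (v - z)"
    using equal_slopes_of_chord[of s z v] assms chord by auto
  have "h s - h v = m z * (v - s)"
    using left right by (simp add: algebra_simps)
  then show ?thesis
    using assms by simp
qed

text \<open>Phrased without derivatives of \<open>h\<close>: the other interior points form an open
  set by construction, and by \<open>straight_of_chord\<close> \<open>h\<close> bends strictly at a
  kink on every scale.\<close>

definition kinks :: "real set" where
  "kinks = {z. 0 < z \<and> z < N c \<and> \<not> (\<exists>s v. 0 \<le> s \<and> s < z \<and> z < v \<and> v \<le> N c \<and> straight s v)}"

text \<open>The second differences of \<open>a\<close> over disjoint neighbourhoods of the kinks are nonzero and pairwise orthogonal.\<close>

lemma card_kinks_le: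
  assumes "finite Z" "Z \<subseteq> kinks"
  shows "card Z \<le> DIM('a)"
proof -
  \<comment> \<open>Including 0 and \<open>N c\<close> keeps the neighbourhoods of the kinks inside
    \<open>{0..N c}\<close>.\<close>
  have "uniform_discrete (insert 0 (insert (N c) Z))"
    using assms(1) uniform_discrete_finite_iff by blast
  then obtain e where e: "0 < e"
    "\<And>x y. x \<in> insert 0 (insert (N c) Z) \<Longrightarrow> y \<in> insert 0 (insert (N c) Z) \<Longrightarrow> x \<noteq> y \<Longrightarrow> e \<le> dist x y"
    unfolding uniform_discrete_def by (meson not_less)
  define \<epsilon> where "\<epsilon> = e / 2"
  have "0 < \<epsilon>"
    using e(1) by (simp add: \<epsilon>_def)
  have Z: "0 < z" "z < N c" if "z \<in> Z" for z
    using that assms(2) by (auto simp: kinks_def)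
  have inside: "0 \<le> z - \<epsilon>" "z + \<epsilon> \<le> N c" if "z \<in> Z" for z
    using e(2)[of z 0] e(2)[of z "N c"] Z[OF that] that \<open>0 < \<epsilon>\<close> by (auto simp: dist_real_def \<epsilon>_def)
  have apart: "z + \<epsilon> \<le> z' - \<epsilon>" if "z \<in> Z" "z' \<in> Z" "z < z'" for z z'
    using e(2)[of z z'] that by (auto simp: dist_real_def \<epsilon>_def)
  define d where "d z = (a z - a (z - \<epsilon>)) - (a (z + \<epsilon>) - a z)" for z
  \<comment> \<open>Equal halves would have equal dual norms, so \<open>h\<close> would drop equally
    on both sides of \<open>z\<close> and a straight interval would surround the kink.\<close>
  have d_nonzero: "d z \<noteq> 0" if "z \<in> Z" for z
  proof
    assume "d z = 0"
    then have "D (a z - a (z - \<epsilon>)) = D (a (z + \<epsilon>) - a z)"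
      by (simp add: d_def)
    then have "h (z - \<epsilon>) - h z = h z - h (z + \<epsilon>)"
      using inside[OF that] \<open>0 < \<epsilon>\<close> by (simp add: increment)
    then have "straight (z - \<epsilon>) (z + \<epsilon>)"
      using inside[OF that] \<open>0 < \<epsilon>\<close> by (intro straight_of_chord[of _ z]) auto
    then show False
      using that assms(2) inside[OF that] \<open>0 < \<epsilon>\<close>
      by (force simp: kinks_def dest!: subsetD)
  qed
  \<comment> \<open>Both halves of \<open>d z\<close> span parameter intervals of length \<epsilon>,
    so their pairings with a later increment cancel.\<close>
  have d_later: "d z \<bullet> (a v - a u) = 0" if "z \<in> Z" "z + \<epsilon> \<le> u" "u \<le> v" "v \<le> N c" for z u v
    using inner_increments[of "z - \<epsilon>" z u v] inner_increments[of z "z + \<epsilon>" u v]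
      inside[OF that(1)] Z[OF that(1)] that \<open>0 < \<epsilon>\<close>
    by (simp add: d_def inner_diff_left)
  have d_ortho_less: "d z \<bullet> d z' = 0" if "z \<in> Z" "z' \<in> Z" "z < z'" for z z'
    unfolding d_def[of z'] inner_diff_right[of "d z" "a z' - _"]
    using d_later[OF that(1), of "z' - \<epsilon>" z'] d_later[OF that(1), of z' "z' + \<epsilon>"]
      apart[OF that] inside[OF that(2)] Z[OF that(2)] \<open>0 < \<epsilon>\<close> by simp
  have d_ortho: "d z \<bullet> d z' = 0" if "z \<in> Z" "z' \<in> Z" "z \<noteq> z'" for z z'
    using d_ortho_less[of z z'] d_ortho_less[of z' z] that by (metis inner_commute linorder_neqE)
  have "inj_on d Z"
    using d_ortho d_nonzero by (metis inj_onI inner_eq_zero_iff)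
  moreover have "independent (d ` Z)"
    using d_ortho d_nonzero
    by (intro pairwise_orthogonal_independent) (auto simp: pairwise_def orthogonal_def)
  then have "card (d ` Z) \<le> DIM('a)"
    using independent_bound by blast
  ultimately show ?thesis
    by (simp add: card_image)
qed

lemma finite_kinks: "finite kinks"
proof (rule ccontr)
  assume "infinite kinks"
  then obtain Z where "finite Z" "card Z = Suc (DIM('a))" "Z \<subseteq> kinks"
    using infinite_arbitrarily_large by blast
  then show False
    using card_kinks_le[of Z] by simp
qed

text \<open>Away from kinks \<open>m\<close> is locally constant by
  \<open>slope_of_straight\<close>, hence constant by connectedness. Subgradients in both directions
  then make \<open>h\<close> affine, and \<open>straight_of_chord\<close> applies at the
  midpoint.\<close>

lemma straight_between_kinks:
  assumes "0 \<le> e" "e < e'" "e' \<le> N c" "{e<..<e'} \<inter> kinks = {}"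
  shows "straight e e'"
proof -
  have interior: "0 < z" "z < N c" if "z \<in> {e<..<e'}" for z
    using that assms by auto
  have m_const: "m z = m z'" if "z \<in> {e<..<e'}" "z' \<in> {e<..<e'}" for z z'
  proof (rule connected_local_const[where A = "{e<..<e'}" and f = m])
    show "\<forall>z\<in>{e<..<e'}. eventually (\<lambda>z'. m z = m z') (at z within {e<..<e'})"
    proof
      fix z assume z: "z \<in> {e<..<e'}"
      then obtain s v where sv: "0 \<le> s" "s < z" "z < v" "v \<le> N c" "straight s v"
        using assms interior[OF z] unfolding kinks_def by blast
      then have eq: "m z' = m z" if "z' \<in> {s<..<v}" for z'
        using that slope_of_straight[of s v] by auto
      have "eventually (\<lambda>z'. z' \<in> {s<..<v}) (at z within {e<..<e'})"
        using sv unfolding eventually_at_topological by (intro exI[of _ "{s<..<v}"]) auto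
      then show "eventually (\<lambda>z'. m z = m z') (at z within {e<..<e'})"
        by eventually_elim (simp add: eq)
    qed
  qed (use that in auto)
  define z where "z = (e + e') / 2"
  have z: "z \<in> {e<..<e'}"
    using assms by (simp add: z_def)
  have const: "h t + m z * t = h z + m z * z" if "t \<in> {e<..<e'}" for t
    using subgradient[of z t] subgradient[of t z] interior[OF z] interior[OF that] m_const[OF z that]
    by (simp add: algebra_simps)
  have closure: "closure {e<..<e'} = {e..e'}"
    using assms(2) by (rule closure_greaterThanLessThan)
  have "h t + m z * t = h z + m z * z" if "t \<in> {e..e'}" for t
  proof (rule continuous_constant_on_closure[where S = "{e<..<e'}" and f = "\<lambda>t. h t + m z * t"])
    show "continuous_on (closure {e<..<e'}) (\<lambda>t. h t + m z * t)"
      using assms unfolding closure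
      by (intro continuous_intros continuous_on_subset[OF continuous_h]) auto
  qed (use const that closure in auto)
  from this[of e] this[of e'] have "h e - h z = m z * (z - e)" "h z - h e' = m z * (e' - z)"
    using assms(2) by (simp_all add: algebra_simps)
  then show ?thesis
    using assms(1,3) z by (intro straight_of_chord[of e z e']) (auto simp: mult_ac)
qed

lemma slope_less_at_kink:
  assumes "z \<in> kinks" "0 \<le> s" "s < z" "z < v" "v \<le> N c"
  shows "(h z - h v) / (v - z) < (h s - h z) / (z - s)"
proof (rule ccontr)
  assume "\<not> ?thesis"
  then have "(h s - h z) * (v - z) \<le> (h z - h v) * (z - s)"
    using assms by (simp add: not_less pos_divide_le_eq pos_le_divide_eq)
  then have "straight s v"
    using assms by (intro straight_of_chord[of s z v]) auto
  then show False
    using assms by (auto simp: kinks_def)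
qed

section \<open>The decomposition cut out by the kinks\<close>

lemma slope_decomp_exists: "\<exists>cs. slope_decomp N c cs"
proof (cases "c = 0")
  case True
  then have "slope_decomp N c []"
    by (simp add: slope_decomp_def)
  then show ?thesis ..
next
  case False
  then have "0 < N c"
    by (simp add: pos_iff)
  define P where "P = insert 0 (insert (N c) kinks)"
  have "finite P" and P_bounds: "\<And>e. e \<in> P \<Longrightarrow> 0 \<le> e \<and> e \<le> N c"
    using finite_kinks \<open>0 < N c\<close> by (auto simp: P_def kinks_def)
  define es where "es = sorted_list_of_set P"
  define r where "r = length es - 1"
  have set_es: "set es = P" and strict: "sorted_wrt (<) es"
    using \<open>finite P\<close> by (simp_all add: es_def)
  \<comment> \<open>The two distinct end points make the list nonempty, so the subtraction in
    \<open>r\<close> is not truncated: r + 1 cut points bound r pieces.\<close>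
  have "card {0, N c} \<le> card P"
    using \<open>finite P\<close> by (intro card_mono) (auto simp: P_def)
  then have length_es: "length es = Suc r"
    using False by (simp add: r_def es_def card_insert_if)
  have mono: "es ! i < es ! j" if "i < j" "j \<le> r" for i j
    using strict that length_es by (simp add: sorted_wrt_nth_less)
  have mono': "es ! i \<le> es ! j" if "i \<le> j" "j \<le> r" for i j
    using mono[of i j] that by (cases "i = j") auto
  have in_P: "es ! i \<in> P" if "i \<le> r" for i
    using that length_es set_es nth_mem[of i es] by simp
  have index: "\<exists>k\<le>r. es ! k = e" if "e \<in> P" for e
    using that length_es by (metis set_es in_set_conv_nth less_Suc_eq_le)
  have bounds: "0 \<le> es ! i" "es ! i \<le> N c" if "i \<le> r" for i
    using P_bounds[OF in_P[OF that]] by auto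
  have first: "es ! 0 = 0"
  proof -
    obtain k where "k \<le> r" "es ! k = 0"
      using index[of 0] by (auto simp: P_def)
    then show ?thesis
      using mono'[of 0 k] bounds(1)[of 0] by simp
  qed
  have last: "es ! r = N c"
  proof -
    obtain k where "k \<le> r" "es ! k = N c"
      using index[of "N c"] by (auto simp: P_def)
    then show ?thesis
      using mono'[of k r] bounds(2)[of r] by simp
  qed
  define cs where "cs = map (\<lambda>i. a (es ! Suc i) - a (es ! i)) [0..<r]"
  have length_cs: "length cs = r"
    by (simp add: cs_def)
  have cs_nth: "cs ! i = a (es ! Suc i) - a (es ! i)" if "i < r" for i
    using that by (simp add: cs_def)
  have N_cs: "N (cs ! i) = es ! Suc i - es ! i"
    and D_cs: "D (cs ! i) = h (es ! i) - h (es ! Suc i)" if "i < r" for i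
    using that bounds[of i] bounds[of "Suc i"] mono[of i "Suc i"] by (simp_all add: cs_nth increment)
  have "sum_list cs = (\<Sum>i<r. a (es ! Suc i) - a (es ! i))"
    by (simp add: sum_list_sum_nth length_cs cs_nth atLeast0LessThan)
  also have "\<dots> = c"
    using sum_lessThan_telescope[of "\<lambda>i. a (es ! i)" r] by (simp add: first last)
  finally have sum: "c = sum_list cs"
    by simp
  have nonzero: "cs ! i \<noteq> 0" if "i < r" for i
    using N_cs[OF that] mono[of i "Suc i"] that by auto
  have inner: "cs ! i \<bullet> cs ! j = N (cs ! i) * D (cs ! j)" if "i \<le> j" "j < r" for i j
  proof (cases "i = j")
    case True
    have "{es ! i<..<es ! Suc i} \<inter> kinks = {}"
    proof (rule ccontr)
      assume "{es ! i<..<es ! Suc i} \<inter> kinks \<noteq> {}"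
      then obtain z where z: "es ! i < z" "z < es ! Suc i" "z \<in> kinks"
        by auto
      then obtain k where k: "k \<le> r" "es ! i < es ! k" "es ! k < es ! Suc i"
        using index[of z] by (auto simp: P_def)
      then have "k \<le> i \<or> Suc i \<le> k"
        by auto
      then show False
        using k mono'[of k i] mono'[of "Suc i" k] that by auto
    qed
    then have "straight (es ! i) (es ! Suc i)"
      using that bounds[of i] bounds[of "Suc i"] mono[of i "Suc i"]
      by (intro straight_between_kinks) auto
    then show ?thesis
      using True that N_cs[of i] D_cs[of i]
      by (simp add: straight_def cs_nth power2_norm_eq_inner)
  next
    case False
    then have "(a (es ! Suc i) - a (es ! i)) \<bullet> (a (es ! Suc j) - a (es ! j))
        = (es ! Suc i - es ! i) * (h (es ! j) - h (es ! Suc j))"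
      using that by (intro inner_increments bounds mono') auto
    then show ?thesis
      using N_cs[of i] D_cs[of j] that by (simp add: cs_nth)
  qed
  have mu: "mu_XY N (cs ! i) = (h (es ! i) - h (es ! Suc i)) / (es ! Suc i - es ! i)" if "i < r" for i
    using that by (simp add: mu_XY_def N_cs D_cs)
  have mu_Suc: "mu_XY N (cs ! Suc i) < mu_XY N (cs ! i)" if "Suc i < r" for i
  proof -
    \<comment> \<open>A cut point strictly between 0 and \<open>N c\<close> is a kink, so
      \<open>slope_less_at_kink\<close> gives strict decrease there.\<close>
    have "es ! Suc i \<in> kinks"
      using in_P[of "Suc i"] mono[of 0 "Suc i"] mono[of "Suc i" r] that first last
      by (auto simp: P_def)
    then show ?thesis
      using that slope_less_at_kink[of "es ! Suc i" "es ! i" "es ! Suc (Suc i)"]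
        mono[of i "Suc i"] mono[of "Suc i" "Suc (Suc i)"] bounds[of i] bounds[of "Suc (Suc i)"]
      by (simp add: mu)
  qed
  have "mu_XY N (cs ! j) < mu_XY N (cs ! i)" if "i < j" "j < r" for i j
    using that
  proof (induction j)
    case (Suc j)
    then show ?case
      using mu_Suc[of j] by (cases "i = j") auto
  qed simp
  then have "slope_decomp N c cs"
    unfolding slope_decomp_def length_cs using sum nonzero inner by (intro conjI allI impI) auto
  then show ?thesis ..
qed

end

theorem theorem2p8:
  fixes NX :: "'a::euclidean_space \<Rightarrow> real"
  assumes "is_norm NX"
  shows "(\<forall>c. tight NX c \<longleftrightarrow> (\<exists>cs. slope_decomp NX c cs))
    \<and> (\<forall>c cs. slope_decomp NX c cs \<longrightarrow>
         (let r = length cs; x = (\<lambda>i. NX (cs ! i)); y = (\<lambda>i. dual_norm NX (cs ! i)) in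
          NX c = (\<Sum>i<r. x i)
          \<and> dual_norm NX c = (\<Sum>i<r. y i)
          \<and> (\<forall>t\<in>{0..NX c}. f_YX NX c t = h_YX NX c t)
          \<and> (\<forall>i<r. \<forall>s\<in>{0..1::real}.
               f_YX NX c ((\<Sum>j<i. x j) + s * x i)
                 = (1 - s) * (\<Sum>j\<in>{i..<r}. y j) + s * (\<Sum>j\<in>{Suc i..<r}. y j))))"
proof -
  interpret norm_dual_pair NX
    using assms by unfold_locales
  have slope: "slope_decomposition NX c cs" if "slope_decomp NX c cs" for c cs
    using that by unfold_locales
  have "\<exists>cs. slope_decomp NX c cs" if "tight NX c" for c
  proof -
    interpret tight_vector NX c
      using that by unfold_locales
    show ?thesis
      by (rule slope_decomp_exists)
  qed
  moreover have "tight NX c" if "slope_decomp NX c cs" for c cs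
    using slope[OF that] by (rule slope_decomposition.tight)
  moreover have "let r = length cs; x = (\<lambda>i. NX (cs ! i)); y = (\<lambda>i. dual_norm NX (cs ! i)) in
      NX c = (\<Sum>i<r. x i)
      \<and> dual_norm NX c = (\<Sum>i<r. y i)
      \<and> (\<forall>t\<in>{0..NX c}. f_YX NX c t = h_YX NX c t)
      \<and> (\<forall>i<r. \<forall>s\<in>{0..1::real}.
           f_YX NX c ((\<Sum>j<i. x j) + s * x i)
             = (1 - s) * (\<Sum>j\<in>{i..<r}. y j) + s * (\<Sum>j\<in>{Suc i..<r}. y j))"
    if "slope_decomp NX c cs" for c cs
  proof -
    interpret slope_decomposition NX c cs
      using that by (rule slope)
    show ?thesis
      using N_c D_c f_eq_h f_YX_abscissa by (simp add: abscissa_def ordinate_def)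
  qed
  ultimately show ?thesis
    by blast
qed

end
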